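(* Let $p$ be a probability density on $\mathbb{R}^d$ such that (i) $p$ is log-concave and $p(x)>0$ for all $x$, and (ii) $p$ is three times differentiable with $M:=\sup_x\|\nabla^3\ln p(x)\|_F<\infty$. Let $f:\mathbb{R}^d\to\mathbb{R}$ be convex, bounded below and $L_f$-smooth, let $\lambda>0$, and let $J(x):=\lambda f(x)-\ln p(x)$. Assume $J$ attains its minimum, let $x^\star_{\rm MAP}$ be a minimiser and $J^\star:=J(x^\star_{\rm MAP})$. Let $y\in\mathbb{R}^d$, $0<\tau\le 1/(\lambda L_f)$, $c>0$, $\eta>0$, and $n_k:=\lfloor c\,k^{1+\eta}\rfloor$ for $k\ge1$. Consider the following approximate proximal gradient algorithm: $\hat x_0=y$ and for $k\ge0$: set $z^{(0)}_{k+1}=\hat x_k-\tau\lambda\nabla f(\hat x_k)$; for $i=0,\dots,n_{k+1}-1$ set $\sigma_i=\sqrt{\tau/(i+1)}$, $\alpha_i=(i+1)/(i+2)$ and $z^{(i+1)}_{k+1}=\alpha_i\,\mathrm{MMSE}_{\sigma_i}(z^{(i)}_{k+1})+(1-\alpha_i)z^{(0)}_{k+1}$; then set $\hat x_{k+1}=z^{(n_{k+1})}_{k+1}$. For $k\ge1$ let $x_k:=\mathrm{prox}_{-\tau\ln p}\big(\hat x_{k-1}-\tau\lambda\nabla f(\hat x_{k-1})\big)$ be the exact proximal update. Then there exist constants $C_1,C_2>0$, depending on the problem parameters ($y$, $\tau$, $\lambda$, $f$, $p$, $d$, $c$, $\eta$) but not on $k$, such that for all $k\ge1$ $$\frac1k\sum_{i=1}^k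 J(x_i)-J^\star\le \frac{C_1}{k}\qquad\text{and}\qquad \|\hat x_k-x_k\|\le C_2\,\frac{1+\ln k}{k^{1+\eta}}.$$
   Context: For $\sigma>0$, $p_\sigma$ denotes the density of $X+\sigma\varepsilon$ with $X\sim p$, $\varepsilon\sim\mathcal N(0,I_d)$ independent, and $\mathrm{MMSE}_\sigma(z):=\mathbb{E}[X\mid X+\sigma\varepsilon=z]$. $\mathrm{prox}_{-\tau\ln p}(u):=\arg\min_x\{\tfrac12\|u-x\|^2-\tau\ln p(x)\}$. For a tensor $A\in\mathbb{R}^{d\times d\times d}$, $\|A\|_F=(\sum_{i,j,k}A_{ijk}^2)^{1/2}$. $L_f$-smooth means $\nabla f$ is $L_f$-Lipschitz. The paper writes the bounds as $O(1/k)$ and $\tilde O(1/k^{1+\eta})$ (the latter hiding logarithmic factors). *)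

theory Defs
  imports "HOL-Analysis.Analysis"
begin

definition gauss_density :: "real \<Rightarrow> 'a::euclidean_space \<Rightarrow> real" where
  "gauss_density \<sigma> u =
     (2 * pi * \<sigma>\<^sup>2) powr (- real DIM('a) / 2) * exp (- (norm u)\<^sup>2 / (2 * \<sigma>\<^sup>2))"

text \<open>Density p_sigma of X + sigma*eps, X ~ p, eps ~ N(0,I) independent (convolution).\<close>
definition smoothed_density :: "('a::euclidean_space \<Rightarrow> real) \<Rightarrow> real \<Rightarrow> 'a \<Rightarrow> real" where
  "smoothed_density p \<sigma> z = (\<integral>x. p x * gauss_density \<sigma> (z - x) \<partial>lborel)"

text \<open>MMSE_sigma(z) = E[X | X + sigma*eps = z], by Bayes' formula for densities.\<close>
definition MMSE :: "('a::euclidean_space \<Rightarrow> real) \<Rightarrow> real \<Rightarrow> 'a \<Rightarrow> 'a" where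
  "MMSE p \<sigma> z =
     (1 / smoothed_density p \<sigma> z) *\<^sub>R (\<integral>x. (p x * gauss_density \<sigma> (z - x)) *\<^sub>R x \<partial>lborel)"

definition prox_neglog :: "real \<Rightarrow> ('a::euclidean_space \<Rightarrow> real) \<Rightarrow> 'a \<Rightarrow> 'a" where
  "prox_neglog \<tau> p u =
     (THE x. \<forall>x'. (1/2) * (norm (u - x))\<^sup>2 - \<tau> * ln (p x) \<le> (1/2) * (norm (u - x'))\<^sup>2 - \<tau> * ln (p x'))"

definition thrice_derivs ::
  "('a::euclidean_space \<Rightarrow> real) \<Rightarrow> ('a \<Rightarrow> 'a \<Rightarrow> real) \<Rightarrow> ('a \<Rightarrow> 'a \<Rightarrow> 'a \<Rightarrow> real)
     \<Rightarrow> ('a \<Rightarrow> 'a \<Rightarrow> 'a \<Rightarrow> 'a \<Rightarrow> real) \<Rightarrow> bool" where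
  "thrice_derivs g D1 D2 D3 \<longleftrightarrow>
     (\<forall>x. (g has_derivative D1 x) (at x)) \<and>
     (\<forall>x u. ((\<lambda>x'. D1 x' u) has_derivative D2 x u) (at x)) \<and>
     (\<forall>x u v. ((\<lambda>x'. D2 x' u v) has_derivative D3 x u v) (at x))"

definition thrice_differentiable :: "('a::euclidean_space \<Rightarrow> real) \<Rightarrow> bool" where
  "thrice_differentiable g \<longleftrightarrow> (\<exists>D1 D2 D3. thrice_derivs g D1 D2 D3)"

definition tensor3_frob :: "('a::euclidean_space \<Rightarrow> 'a \<Rightarrow> 'a \<Rightarrow> real) \<Rightarrow> real" where
  "tensor3_frob T = sqrt (\<Sum>i\<in>Basis. \<Sum>j\<in>Basis. \<Sum>k\<in>Basis. (T i j k)\<^sup>2)"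

fun inner_z :: "('a::euclidean_space \<Rightarrow> real) \<Rightarrow> real \<Rightarrow> 'a \<Rightarrow> nat \<Rightarrow> 'a" where
  "inner_z p \<tau> z0 0 = z0"
| "inner_z p \<tau> z0 (Suc i) =
     (let \<sigma> = sqrt (\<tau> / (real i + 1)); \<alpha> = (real i + 1) / (real i + 2)
      in \<alpha> *\<^sub>R MMSE p \<sigma> (inner_z p \<tau> z0 i) + (1 - \<alpha>) *\<^sub>R z0)"

definition n_iter :: "real \<Rightarrow> real \<Rightarrow> nat \<Rightarrow> nat" where
  "n_iter c \<eta> k = nat \<lfloor>c * real k powr (1 + \<eta>)\<rfloor>"

fun xhat :: "('a::euclidean_space \<Rightarrow> real) \<Rightarrow> ('a \<Rightarrow> 'a) \<Rightarrow> real \<Rightarrow> real \<Rightarrow> real \<Rightarrow> real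
              \<Rightarrow> 'a \<Rightarrow> nat \<Rightarrow> 'a" where
  "xhat p gf \<tau> lam c \<eta> y 0 = y"
| "xhat p gf \<tau> lam c \<eta> y (Suc k) =
     (let xk = xhat p gf \<tau> lam c \<eta> y k
      in inner_z p \<tau> (xk - (\<tau> * lam) *\<^sub>R gf xk) (n_iter c \<eta> (Suc k)))"

text \<open>Exact proximal update x_k (meaningful for k >= 1).\<close>
definition xexact :: "('a::euclidean_space \<Rightarrow> real) \<Rightarrow> ('a \<Rightarrow> 'a) \<Rightarrow> real \<Rightarrow> real \<Rightarrow> real \<Rightarrow> real
              \<Rightarrow> 'a \<Rightarrow> nat \<Rightarrow> 'a" where
  "xexact p gf \<tau> lam c \<eta> y k =
     (let xp = xhat p gf \<tau> lam c \<eta> y (k - 1)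
      in prox_neglog \<tau> p (xp - (\<tau> * lam) *\<^sub>R gf xp))"

end

theory Submission
  imports Defs
begin

text \<open>
  By Tweedie's formula the inner loop is gradient descent with steps \<open>1/(i+2)\<close> on smoothed proximal
  objectives. The point is to compare \<open>MMSE\<^sub>\<sigma>\<close> with the proximal map of \<open>- \<sigma>\<^sup>2 ln p\<close>, that is, the mean of
  the posterior with its mode \<open>m\<close>. The posterior potential \<open>V\<close> is \<open>\<sigma>\<^sup>-\<^sup>2\<close>-strongly convex, so
  \<open>E[|X - m|\<^sup>2] \<le> d \<sigma>\<^sup>2\<close>, and expanding \<open>E[\<nabla>V(X)] = 0\<close> around \<open>m\<close> with the Lipschitz Hessian gives
  \<open>|E[X] - m| = O(\<sigma>\<^sup>4)\<close>, uniformly in the observation. As proximal maps are nonexpansive, the distance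
  \<open>e\<^sub>i\<close> of the inner iterate to the exact update satisfies \<open>(i+2) e\<^sub>i\<^sub>+\<^sub>1 \<le> (i+1) e\<^sub>i + O(1/(i+1))\<close>, hence
  \<open>e\<^sub>n = O((1 + ln n)/n)\<close>, with a constant that is uniform on bounded sets. The outer iterates stay
  bounded: gradient step and inner loop are nonexpansive up to summable errors, and starting the inner
  loop at \<open>x\<^sup>* - \<tau> \<lambda> \<nabla>f(x\<^sup>*)\<close> nearly returns \<open>x\<^sup>*\<close>. The ergodic rate is the telescoped proximal gradient
  inequality, perturbed by summable errors.
\<close>

section \<open>Convex functions with Lipschitz gradient\<close>

text \<open>Restricting \<open>f\<close> to the line through \<open>x\<close> and \<open>y\<close>
  reduces this to the tangent inequality in one variable.\<close>

lemma convex_on_gradient_le: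
  fixes f :: "'a::euclidean_space \<Rightarrow> real"
  assumes "convex_on UNIV f" and "(f has_derivative (\<lambda>h. v \<bullet> h)) (at x)"
  shows "f x + v \<bullet> (y - x) \<le> f y"
proof -
  define q where "q t = f (x + t *\<^sub>R (y - x))" for t :: real
  have "convex_on UNIV q"
  proof (rule convex_onI)
    fix t a b :: real assume t: "0 < t" "t < 1"
    have "x + ((1 - t) *\<^sub>R a + t *\<^sub>R b) *\<^sub>R (y - x)
        = (1 - t) *\<^sub>R (x + a *\<^sub>R (y - x)) + t *\<^sub>R (x + b *\<^sub>R (y - x))"
      by (simp add: algebra_simps)
    then show "q ((1 - t) *\<^sub>R a + t *\<^sub>R b) \<le> (1 - t) * q a + t * q b"
      using convex_onD[OF assms(1), of t "x + a *\<^sub>R (y - x)" "x + b *\<^sub>R (y - x)"] t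
      by (simp add: q_def)
  qed simp
  moreover have "(q has_field_derivative v \<bullet> (y - x)) (at 0)"
  proof -
    have f: "(f has_derivative (\<lambda>h. v \<bullet> h)) (at (x + 0 *\<^sub>R (y - x)))"
      using assms(2) by simp
    have "((\<lambda>t. x + t *\<^sub>R (y - x)) has_derivative (\<lambda>t. t *\<^sub>R (y - x))) (at (0::real))"
      by (auto intro!: derivative_eq_intros)
    from has_derivative_compose[OF this f]
    show ?thesis
      by (simp add: q_def[abs_def] has_field_derivative_def mult_commute_abs)
  qed
  ultimately have "v \<bullet> (y - x) * (1 - 0) \<le> q 1 - q 0"
    by (intro convex_on_imp_above_tangent[where A = UNIV]) auto
  then show ?thesis by (simp add: q_def)
qed

lemma convex_on_gradient_mono:
  fixes f :: "'a::euclidean_space \<Rightarrow> real"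
  assumes "convex_on UNIV f" and "\<And>x. (f has_derivative (\<lambda>h. g x \<bullet> h)) (at x)"
  shows "0 \<le> (g x - g y) \<bullet> (x - y)"
  using convex_on_gradient_le[OF assms, of x y] convex_on_gradient_le[OF assms, of y x]
  by (simp add: inner_simps inner_commute)

text \<open>Along the segment, \<open>q\<close> is \<open>f\<close> minus its quadratic upper model.
  The Lipschitz bound on the gradient makes its derivative nonpositive.\<close>

lemma smooth_descent:
  fixes f :: "'a::euclidean_space \<Rightarrow> real"
  assumes "\<And>x. (f has_derivative (\<lambda>h. g x \<bullet> h)) (at x)"
    and lip: "\<And>x y. norm (g x - g y) \<le> L * norm (x - y)"
  shows "f y \<le> f x + g x \<bullet> (y - x) + L / 2 * (norm (y - x))\<^sup>2"
proof -
  define q where "q t = f (x + t *\<^sub>R (y - x)) - t * (g x \<bullet> (y - x)) - L / 2 * t\<^sup>2 * (norm (y - x))\<^sup>2"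
    for t :: real
  have "q 1 \<le> q 0"
  proof (rule DERIV_nonpos_imp_nonincreasing[where f = q])
    fix t :: real assume t: "0 \<le> t" "t \<le> 1"
    have "((\<lambda>t. x + t *\<^sub>R (y - x)) has_derivative (\<lambda>t. t *\<^sub>R (y - x))) (at t)"
      by (auto intro!: derivative_eq_intros)
    from has_derivative_compose[OF this assms(1)]
    have "((\<lambda>t. f (x + t *\<^sub>R (y - x))) has_field_derivative g (x + t *\<^sub>R (y - x)) \<bullet> (y - x)) (at t)"
      by (simp add: has_field_derivative_def mult_commute_abs)
    then have "(q has_field_derivative
        (g (x + t *\<^sub>R (y - x)) - g x) \<bullet> (y - x) - L * t * (norm (y - x))\<^sup>2) (at t)"
      unfolding q_def by (auto intro!: derivative_eq_intros simp: inner_simps algebra_simps)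
    moreover have "(g (x + t *\<^sub>R (y - x)) - g x) \<bullet> (y - x) \<le> L * t * (norm (y - x))\<^sup>2"
    proof -
      have "(g (x + t *\<^sub>R (y - x)) - g x) \<bullet> (y - x)
          \<le> norm (g (x + t *\<^sub>R (y - x)) - g x) * norm (y - x)"
        by (rule norm_cauchy_schwarz)
      also have "\<dots> \<le> (L * norm (x + t *\<^sub>R (y - x) - x)) * norm (y - x)"
        by (intro mult_right_mono lip) auto
      also have "\<dots> = L * t * (norm (y - x))\<^sup>2"
        using t by (simp add: power2_eq_square)
      finally show ?thesis .
    qed
    ultimately show "\<exists>d. (q has_real_derivative d) (at t) \<and> d \<le> 0"
      by (intro exI[of _ "(g (x + t *\<^sub>R (y - x)) - g x) \<bullet> (y - x) - L * t * (norm (y - x))\<^sup>2"]) auto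
  qed auto
  then show ?thesis by (simp add: q_def)
qed

text \<open>The Baillon-Haddad inequality: the refined lower bound \<open>key\<close>, added to
  itself with \<open>x\<close> and \<open>y\<close> exchanged.\<close>

lemma gradient_cocoercive:
  fixes f :: "'a::euclidean_space \<Rightarrow> real"
  assumes cvx: "convex_on UNIV f" and deriv: "\<And>x. (f has_derivative (\<lambda>h. g x \<bullet> h)) (at x)"
    and "0 < L" and lip: "\<And>x y. norm (g x - g y) \<le> L * norm (x - y)"
  shows "(norm (g x - g y))\<^sup>2 \<le> L * ((g x - g y) \<bullet> (x - y))"
proof -
  have key: "f x + g x \<bullet> (y - x) + (norm (g y - g x))\<^sup>2 / (2 * L) \<le> f y" for x y
  proof -
    \<comment> \<open>\<open>w\<close> minimises the quadratic upper model at \<open>y\<close> of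
      \<open>f\<close> tilted by \<open>- g x\<close>. The tangent at \<open>x\<close> bounds
      \<open>f w\<close> from below, the descent inequality from above.\<close>
    define w where "w = y - (1 / L) *\<^sub>R (g y - g x)"
    have "f x + g x \<bullet> (w - x) \<le> f w"
      by (rule convex_on_gradient_le[OF cvx deriv])
    also have "f w \<le> f y + g y \<bullet> (w - y) + L / 2 * (norm (w - y))\<^sup>2"
      by (rule smooth_descent[OF deriv lip])
    finally have "f x + g x \<bullet> (y - x) \<le> f y + (g y - g x) \<bullet> (w - y) + L / 2 * (norm (w - y))\<^sup>2"
      by (simp add: inner_simps)
    moreover have "(g y - g x) \<bullet> (w - y) = - (norm (g y - g x))\<^sup>2 / L"
      by (simp add: w_def power2_norm_eq_inner)
    moreover have "L / 2 * (norm (w - y))\<^sup>2 = (norm (g y - g x))\<^sup>2 / (2 * L)"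
    proof -
      have "norm (w - y) = norm (g y - g x) / L"
        using \<open>0 < L\<close> by (simp add: w_def del: scaleR_right_diff_distrib)
      then show ?thesis using \<open>0 < L\<close> by (simp add: field_simps power2_eq_square)
    qed
    ultimately show ?thesis using \<open>0 < L\<close> by (simp add: field_simps)
  qed
  have "(norm (g x - g y))\<^sup>2 / L \<le> (g x - g y) \<bullet> (x - y)"
    using key[of x y] key[of y x]
    by (simp add: inner_simps norm_minus_commute[of "g y"] field_simps)
  then show ?thesis using \<open>0 < L\<close> by (simp add: field_simps)
qed

text \<open>In the expanded square, cocoercivity and \<open>r * L\<close> at most 2 make the cross
  term dominate the term quadratic in \<open>r\<close>.\<close>

lemma gradient_step_nonexpansive:
  fixes f :: "'a::euclidean_space \<Rightarrow> real"
  assumes "convex_on UNIV f" and "\<And>x. (f has_derivative (\<lambda>h. g x \<bullet> h)) (at x)"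
    and "0 < L" and "\<And>x y. norm (g x - g y) \<le> L * norm (x - y)"
    and "0 \<le> r" and "r \<le> 2 / L"
  shows "norm ((x - r *\<^sub>R g x) - (y - r *\<^sub>R g y)) \<le> norm (x - y)"
proof (rule power2_le_imp_le)
  have coc: "(norm (g x - g y))\<^sup>2 \<le> L * ((g x - g y) \<bullet> (x - y))"
    by (rule gradient_cocoercive[OF assms(1-4)])
  then have "0 \<le> (g x - g y) \<bullet> (x - y)"
    using \<open>0 < L\<close> by (meson order_trans zero_le_power2 zero_le_mult_iff not_less)
  have "r * (norm (g x - g y))\<^sup>2 \<le> r * (L * ((g x - g y) \<bullet> (x - y)))"
    using coc \<open>0 \<le> r\<close> by (rule mult_left_mono)
  also have "\<dots> = (r * L) * ((g x - g y) \<bullet> (x - y))" by simp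
  also have "\<dots> \<le> 2 * ((g x - g y) \<bullet> (x - y))"
    using assms(3,6) \<open>0 \<le> (g x - g y) \<bullet> (x - y)\<close> by (intro mult_right_mono) (auto simp: field_simps)
  finally have "r * (r * (norm (g x - g y))\<^sup>2) \<le> r * (2 * ((g x - g y) \<bullet> (x - y)))"
    using \<open>0 \<le> r\<close> by (intro mult_left_mono)
  moreover have "(norm ((x - r *\<^sub>R g x) - (y - r *\<^sub>R g y)))\<^sup>2
      = (norm (x - y))\<^sup>2 - r * (2 * ((g x - g y) \<bullet> (x - y))) + r * (r * (norm (g x - g y))\<^sup>2)"
    by (simp add: power2_norm_eq_inner inner_simps algebra_simps inner_commute)
  ultimately show "(norm ((x - r *\<^sub>R g x) - (y - r *\<^sub>R g y)))\<^sup>2 \<le> (norm (x - y))\<^sup>2"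
    by linarith
qed auto

section \<open>Smooth log-concave densities and the proximal map\<close>

text \<open>\<open>g\<close> and \<open>H\<close> are the gradient and the Hessian of the potential
  \<open>- ln p\<close>, not of \<open>ln p\<close>. The bound on the third derivative enters as the
  Lipschitz constant \<open>K\<close> of the Hessian.\<close>

locale smooth_logconcave =
  fixes p :: "'a::euclidean_space \<Rightarrow> real" and g :: "'a \<Rightarrow> 'a" and H :: "'a \<Rightarrow> 'a \<Rightarrow> 'a" and K :: real
  assumes p_pos: "0 < p x"
    and p_int: "integrable lborel p"
    and convex: "convex_on UNIV (\<lambda>x. - ln (p x))"
    and deriv: "((\<lambda>x. - ln (p x)) has_derivative (\<lambda>h. g x \<bullet> h)) (at x)"
    and deriv2: "(g has_derivative H x) (at x)"
    and H_lip: "norm (H x h - H y h) \<le> K * norm (x - y) * norm h"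
    and K_nonneg: "0 \<le> K"
begin

section \<open>Gradient and Hessian of the potential \<open>- ln p\<close>\<close>

lemma tangent_le: "ln (p y) \<le> ln (p x) - g x \<bullet> (y - x)"
  using convex_on_gradient_le[OF convex deriv, of x y] by simp

lemma g_mono: "0 \<le> (g x - g y) \<bullet> (x - y)"
  by (rule convex_on_gradient_mono[OF convex deriv])

lemma linear_H: "linear (H x)"
  using deriv2 by (rule has_derivative_linear)

text \<open>The quadratic form is the limit of difference quotients of \<open>g\<close> along
  \<open>h\<close>, which are nonnegative because \<open>g\<close> is monotone.\<close>

lemma H_nonneg: "0 \<le> H x h \<bullet> h"
proof -
  have "((\<lambda>t. x + t *\<^sub>R h) has_derivative (\<lambda>t. t *\<^sub>R h)) (at (0::real))"
    by (auto intro!: derivative_eq_intros)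
  moreover have "(g has_derivative H x) (at (x + 0 *\<^sub>R h))"
    using deriv2 by simp
  ultimately have "((\<lambda>t. g (x + t *\<^sub>R h)) has_derivative (\<lambda>t. H x (t *\<^sub>R h))) (at 0)"
    by (rule has_derivative_compose)
  then have "((\<lambda>t. g (x + t *\<^sub>R h) \<bullet> h) has_derivative (\<lambda>t. H x (t *\<^sub>R h) \<bullet> h)) (at 0)"
    by (auto intro!: derivative_eq_intros)
  then have "((\<lambda>t. g (x + t *\<^sub>R h) \<bullet> h) has_field_derivative H x h \<bullet> h) (at 0)"
    by (simp add: has_field_derivative_def linear_cmul[OF linear_H] mult_commute_abs)
  then have "(\<lambda>t. (g (x + t *\<^sub>R h) \<bullet> h - g x \<bullet> h) / t) \<midarrow>0\<rightarrow> H x h \<bullet> h"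
    by (simp add: DERIV_def)
  moreover have "0 \<le> (g (x + t *\<^sub>R h) \<bullet> h - g x \<bullet> h) / t" for t :: real
  proof -
    have "0 \<le> t * ((g (x + t *\<^sub>R h) - g x) \<bullet> h)"
      using g_mono[of "x + t *\<^sub>R h" x] by simp
    then show ?thesis
      by (auto simp: inner_simps zero_le_mult_iff zero_le_divide_iff)
  qed
  ultimately show ?thesis
    by (intro tendsto_lowerbound[where F = "at (0::real)"]) auto
qed

text \<open>The mean value inequality for \<open>g\<close> minus its linearisation at
  \<open>m\<close>. It yields the constant \<open>K\<close> rather than the \<open>K / 2\<close> of
  an integral remainder.\<close>

lemma g_taylor: "norm (g x - g m - H m (x - m)) \<le> K * (norm (x - m))\<^sup>2"
proof -
  have "norm (g x - g m - H m (x - m)) \<le> norm (x - m) * (K * norm (x - m))"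
  proof (rule differentiable_bound_linearization[where S = "closed_segment m x" and f = g and f' = H and ?x0.0 = m])
    show "\<And>t. t \<in> {0..1} \<Longrightarrow> m + t *\<^sub>R (x - m) \<in> closed_segment m x"
      by (auto simp: in_segment algebra_simps)
    show "\<And>y. y \<in> closed_segment m x \<Longrightarrow> (g has_derivative H y) (at y within closed_segment m x)"
      by (rule has_derivative_at_withinI[OF deriv2])
    fix y assume "y \<in> closed_segment m x"
    then have "norm (y - m) \<le> norm (x - m)" by (rule segment_bound1)
    show "onorm (H y - H m) \<le> K * norm (x - m)"
    proof (rule onorm_le)
      fix h
      have "norm (H y h - H m h) \<le> K * norm (y - m) * norm h" by (rule H_lip)
      also have "\<dots> \<le> K * norm (x - m) * norm h"
        using \<open>norm (y - m) \<le> norm (x - m)\<close> K_nonneg by (intro mult_right_mono mult_left_mono) auto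
      finally show "norm ((H y - H m) h) \<le> K * norm (x - m) * norm h" by simp
    qed
  qed simp
  then show ?thesis by (simp add: power2_eq_square mult_ac)
qed

text \<open>The Hessian may grow linearly, so the Lipschitz constant depends on the ball. This is
  one reason why the outer iterates must be shown to be bounded.\<close>

lemma g_lipschitz_on_cball:
  assumes "x \<in> cball 0 R" "y \<in> cball 0 R"
  shows "norm (g x - g y) \<le> (onorm (H 0) + K * R) * norm (x - y)"
proof (rule differentiable_bound[where S = "cball 0 R"])
  fix w :: 'a assume "w \<in> cball 0 R"
  show "onorm (H w) \<le> onorm (H 0) + K * R"
  proof (rule onorm_le)
    fix h
    have "norm (H w h) \<le> norm (H 0 h) + norm (H w h - H 0 h)" by (metis add.commute norm_triangle_sub)
    also have "\<dots> \<le> onorm (H 0) * norm h + K * norm (w - 0) * norm h"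
      by (intro add_mono H_lip onorm linear_linear[THEN iffD2] has_derivative_bounded_linear[OF deriv2])
    also have "\<dots> \<le> onorm (H 0) * norm h + K * R * norm h"
      using \<open>w \<in> cball 0 R\<close> K_nonneg by (intro add_left_mono mult_right_mono mult_left_mono) auto
    finally show "norm (H w h) \<le> (onorm (H 0) + K * R) * norm h" by (simp add: algebra_simps)
  qed
qed (use assms in \<open>auto intro: has_derivative_at_withinI[OF deriv2]\<close>)

text \<open>A solution of the stationarity equation is a minimiser with quadratic growth, the growth
  coming from the quadratic term alone. It yields uniqueness of the minimiser here and the
  three-point inequality of the outer iteration later.\<close>

lemma prox_objective_strong:
  assumes "m + s *\<^sub>R g m = z" and "0 < s"
  shows "1/2 * (norm (z - m))\<^sup>2 - s * ln (p m) + 1/2 * (norm (x - m))\<^sup>2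
    \<le> 1/2 * (norm (z - x))\<^sup>2 - s * ln (p x)"
proof -
  have "s * ln (p x) \<le> s * (ln (p m) - g m \<bullet> (x - m))"
    using tangent_le \<open>0 < s\<close> by (intro mult_left_mono) auto
  also have "\<dots> = s * ln (p m) - (z - m) \<bullet> (x - m)"
    unfolding assms(1)[symmetric] by (simp add: algebra_simps)
  finally show ?thesis
    by (simp add: power2_norm_eq_inner inner_simps algebra_simps inner_commute)
qed

lemma prox_neglog_eqI:
  assumes "m + s *\<^sub>R g m = z" and "0 < s"
  shows "prox_neglog s p z = m"
  unfolding prox_neglog_def
proof (rule the_equality)
  show "\<forall>x'. 1/2 * (norm (z - m))\<^sup>2 - s * ln (p m) \<le> 1/2 * (norm (z - x'))\<^sup>2 - s * ln (p x')"
  proof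
    fix x' show "1/2 * (norm (z - m))\<^sup>2 - s * ln (p m) \<le> 1/2 * (norm (z - x'))\<^sup>2 - s * ln (p x')"
      using prox_objective_strong[OF assms, of x'] zero_le_power2[of "norm (x' - m)"] by linarith
  qed
  fix x assume "\<forall>x'. 1/2 * (norm (z - x))\<^sup>2 - s * ln (p x) \<le> 1/2 * (norm (z - x'))\<^sup>2 - s * ln (p x')"
  from spec[OF this, of m] have "(norm (x - m))\<^sup>2 \<le> 0"
    using prox_objective_strong[OF assms, of x] by linarith
  then show "x = m" by simp
qed

text \<open>The objective attains its minimum on a compact ball. Outside the ball it is at least its
  value at the centre \<open>z\<close>, so the minimum is global and the derivative vanishes
  there.\<close>

lemma ex_prox_equation:
  assumes "0 < s"
  shows "\<exists>m. m + s *\<^sub>R g m = z"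
proof -
  define V where "V x = 1/2 * (norm (x - z))\<^sup>2 + s * (- ln (p x))" for x
  \<comment> \<open>Beyond this distance from \<open>z\<close> the quadratic term outweighs the
    slope \<open>s * norm (g z)\<close> of the linear lower bound.\<close>
  define R where "R = 2 * s * norm (g z)"
  have dV: "(V has_derivative (\<lambda>h. ((x - z) + s *\<^sub>R g x) \<bullet> h)) (at x)" for x
    unfolding V_def power2_norm_eq_inner
    by (rule derivative_eq_intros deriv refl | simp add: inner_simps inner_commute algebra_simps)+
  have "continuous_on (cball z R) V"
    by (meson dV continuous_at_imp_continuous_on has_derivative_continuous)
  moreover have "0 \<le> R" using \<open>0 < s\<close> by (simp add: R_def)
  ultimately obtain m where m: "m \<in> cball z R" "\<And>x. x \<in> cball z R \<Longrightarrow> V m \<le> V x"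
    using continuous_attains_inf[of "cball z R" V] by auto
  have "V m \<le> V x" for x
  proof (cases "x \<in> cball z R")
    case False
    then have "R < norm (x - z)" by (simp add: dist_norm norm_minus_commute)
    have "- (s * norm (g z) * norm (x - z)) \<le> s * (g z \<bullet> (x - z))"
      using Cauchy_Schwarz_ineq2[of "g z" "x - z"] \<open>0 < s\<close>
        mult_left_mono[of "- (norm (g z) * norm (x - z))" "g z \<bullet> (x - z)" s] by (simp add: abs_le_iff)
    moreover have "s * (g z \<bullet> (x - z)) \<le> s * (ln (p z) - ln (p x))"
      using tangent_le[of x z] \<open>0 < s\<close> by (intro mult_left_mono) auto
    moreover have "s * norm (g z) * norm (x - z) \<le> 1/2 * norm (x - z) * norm (x - z)"
      using \<open>R < norm (x - z)\<close> by (intro mult_right_mono) (auto simp: R_def)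
    ultimately have "V z \<le> V x" by (simp add: V_def power2_eq_square algebra_simps)
    moreover have "V m \<le> V z" using m(2)[of z] \<open>0 \<le> R\<close> by simp
    ultimately show ?thesis by linarith
  qed (rule m(2))
  then have "(\<lambda>h. ((m - z) + s *\<^sub>R g m) \<bullet> h) = (\<lambda>h. 0)"
    by (intro has_derivative_local_min[OF dV]) (simp add: always_eventually)
  then have "((m - z) + s *\<^sub>R g m) \<bullet> ((m - z) + s *\<^sub>R g m) = 0" by metis
  then have "(m - z) + s *\<^sub>R g m = 0" by (simp only: inner_eq_zero_iff)
  then have "m + s *\<^sub>R g m = z" by (simp add: algebra_simps)
  then show ?thesis ..
qed

lemma prox_equation:
  assumes "0 < s"
  shows "prox_neglog s p z + s *\<^sub>R g (prox_neglog s p z) = z"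
  using ex_prox_equation[OF assms] prox_neglog_eqI[OF _ assms] by metis

text \<open>The difference of the two stationarity equations is paired with \<open>a - b\<close>;
  the term with \<open>g\<close> is nonnegative by monotonicity.\<close>

lemma prox_nonexpansive:
  assumes "0 < s"
  shows "norm (prox_neglog s p z - prox_neglog s p w) \<le> norm (z - w)"
proof -
  define a b where "a = prox_neglog s p z" and "b = prox_neglog s p w"
  have "z - w = (a - b) + s *\<^sub>R (g a - g b)"
    using prox_equation[OF assms, of z] prox_equation[OF assms, of w]
    by (simp add: a_def b_def algebra_simps)
  then have "(z - w) \<bullet> (a - b) = (norm (a - b))\<^sup>2 + s * ((g a - g b) \<bullet> (a - b))"
    by (simp only: inner_add_left inner_scaleR_left power2_norm_eq_inner)
  then have "norm (a - b) * norm (a - b) \<le> (z - w) \<bullet> (a - b)"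
    using g_mono[of a b] \<open>0 < s\<close> by (simp add: power2_eq_square)
  also have "\<dots> \<le> norm (z - w) * norm (a - b)" by (rule norm_cauchy_schwarz)
  finally show ?thesis unfolding a_def b_def by (cases "norm (a - b) = 0") (auto simp: a_def b_def mult_le_cancel_right)
qed

text \<open>The point \<xi> is itself the proximal point of a known input,
  \<open>\<xi> + s *\<^sub>R g \<xi>\<close>, so nonexpansiveness applies.\<close>

lemma prox_displacement:
  assumes "0 < s"
  shows "norm (prox_neglog s p \<xi> - \<xi>) \<le> s * norm (g \<xi>)"
proof -
  have "prox_neglog s p (\<xi> + s *\<^sub>R g \<xi>) = \<xi>" by (rule prox_neglog_eqI[OF refl assms])
  then show ?thesis
    using prox_nonexpansive[OF assms, of \<xi> "\<xi> + s *\<^sub>R g \<xi>"] \<open>0 < s\<close> by simp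
qed

end

section \<open>Posterior mean and posterior mode\<close>

lemma integrable_lborel_affine:
  fixes f :: "'a::euclidean_space \<Rightarrow> real"
  assumes "integrable lborel f" and "0 < c"
  shows "integrable lborel (\<lambda>x. f (t + c *\<^sub>R x))"
proof -
  have [measurable]: "f \<in> borel_measurable borel" using assms(1) by auto
  have "integrable (density (distr lborel borel (\<lambda>x. t + c *\<^sub>R x)) (\<lambda>_. ennreal (\<bar>c\<bar> ^ DIM('a)))) f"
    using assms lborel_affine[of c t] by simp
  then have "integrable (distr lborel borel (\<lambda>x. t + c *\<^sub>R x)) (\<lambda>x. \<bar>c\<bar> ^ DIM('a) *\<^sub>R f x)"
    by (subst (asm) integrable_density) auto
  then have "integrable lborel (\<lambda>x. \<bar>c\<bar> ^ DIM('a) *\<^sub>R f (t + c *\<^sub>R x))"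
    by (subst (asm) integrable_distr_eq) auto
  then show ?thesis using \<open>0 < c\<close> by simp
qed

lemma integral_lborel_affine:
  fixes f :: "'a::euclidean_space \<Rightarrow> real"
  assumes [measurable]: "f \<in> borel_measurable borel" and "0 < c"
  shows "(\<integral>x. f x \<partial>lborel) = c ^ DIM('a) * (\<integral>x. f (t + c *\<^sub>R x) \<partial>lborel)"
proof -
  have "(\<integral>x. f x \<partial>lborel)
      = (\<integral>x. f x \<partial>density (distr lborel borel (\<lambda>x. t + c *\<^sub>R x)) (\<lambda>_. ennreal (\<bar>c\<bar> ^ DIM('a))))"
    using assms lborel_affine[of c t] by simp
  also have "\<dots> = (\<integral>x. \<bar>c\<bar> ^ DIM('a) *\<^sub>R f x \<partial>distr lborel borel (\<lambda>x. t + c *\<^sub>R x))"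
    by (subst integral_density) auto
  also have "\<dots> = (\<integral>x. \<bar>c\<bar> ^ DIM('a) *\<^sub>R f (t + c *\<^sub>R x) \<partial>lborel)"
    by (subst integral_distr) auto
  finally show ?thesis using \<open>0 < c\<close> by simp
qed

lemma norm_add_power2_le:
  fixes x y :: "'a::real_inner"
  shows "(norm (x + y))\<^sup>2 \<le> 2 * (norm x)\<^sup>2 + 2 * (norm y)\<^sup>2"
  using inner_ge_zero[of "x - y"]
  by (simp add: power2_norm_eq_inner inner_add_left inner_add_right inner_diff_left inner_diff_right
      inner_commute)

text \<open>The product of the quadratic Taylor polynomials at \<open>a\<close> and
  \<open>- a\<close> is at least 1, and the first factor is at most \<open>exp a\<close>.\<close>

lemma exp_minus_le_quadratic:
  fixes a :: real
  assumes "0 \<le> a"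
  shows "exp (- a) \<le> 1 - a + a\<^sup>2 / 2"
proof -
  have "(1 + a + a\<^sup>2 / 2) * (1 - a + a\<^sup>2 / 2) = 1 + (a\<^sup>2)\<^sup>2 / 4"
    by (simp add: power2_eq_square field_simps)
  then have *: "1 \<le> (1 + a + a\<^sup>2 / 2) * (1 - a + a\<^sup>2 / 2)" by simp
  have "0 \<le> 1 - a + a\<^sup>2 / 2"
    using zero_le_power2[of "a - 1"] by (simp add: power2_eq_square algebra_simps)
  then have "(1 + a + a\<^sup>2 / 2) * (1 - a + a\<^sup>2 / 2) \<le> exp a * (1 - a + a\<^sup>2 / 2)"
    using exp_lower_Taylor_quadratic[OF assms] by (intro mult_right_mono)
  with * have "1 \<le> exp a * (1 - a + a\<^sup>2 / 2)" by linarith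
  then show ?thesis by (simp add: exp_minus field_simps)
qed

section \<open>Moments of the posterior about its mode\<close>

context smooth_logconcave
begin

text \<open>The unnormalised posterior density of the signal given the observation \<open>z\<close>,
  where \<open>s\<close> is the noise variance. The Gaussian constant is left out because it cancels
  in the posterior mean.\<close>

definition weight :: "real \<Rightarrow> 'a \<Rightarrow> 'a \<Rightarrow> real" where
  "weight s z x = p x * exp (- (norm (z - x))\<^sup>2 / (2 * s))"

lemma weight_pos: "0 < weight s z x"
  using p_pos by (simp add: weight_def)

lemma p_measurable [measurable]: "p \<in> borel_measurable borel"
  using borel_measurable_integrable[OF p_int] by simp

lemma weight_measurable [measurable]: "weight s z \<in> borel_measurable borel"
  unfolding weight_def by measurable

text \<open>The negative logarithm of the weight is strongly convex with modulus
  \<open>1 / s\<close> and has gradient \<open>g y + (y - z) / s\<close> at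
  \<open>y\<close>.\<close>

lemma weight_tangent:
  assumes "0 < s"
  shows "weight s z x \<le> weight s z y
    * exp (- (g y \<bullet> (x - y)) - (y - z) \<bullet> (x - y) / s - (norm (x - y))\<^sup>2 / (2 * s))"
proof -
  have "p x = exp (ln (p x))" using p_pos by simp
  also have "\<dots> \<le> exp (ln (p y) - g y \<bullet> (x - y))" using tangent_le by simp
  also have "\<dots> = p y * exp (- (g y \<bullet> (x - y)))" using p_pos by (simp add: exp_diff exp_minus field_simps)
  finally have "p x \<le> p y * exp (- (g y \<bullet> (x - y)))" .
  moreover have "- (norm (z - x))\<^sup>2 / (2 * s)
      = - (norm (z - y))\<^sup>2 / (2 * s) + (- ((y - z) \<bullet> (x - y) / s) - (norm (x - y))\<^sup>2 / (2 * s))"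
    using assms by (simp add: power2_norm_eq_inner inner_simps field_simps inner_commute)
  ultimately have "weight s z x \<le> (p y * exp (- (g y \<bullet> (x - y))))
      * exp (- (norm (z - y))\<^sup>2 / (2 * s) + (- ((y - z) \<bullet> (x - y) / s) - (norm (x - y))\<^sup>2 / (2 * s)))"
    unfolding weight_def by (intro mult_mono) (auto simp: less_imp_le[OF p_pos])
  also have "\<dots> = weight s z y
      * exp (- (g y \<bullet> (x - y)) + (- ((y - z) \<bullet> (x - y) / s) - (norm (x - y))\<^sup>2 / (2 * s)))"
    by (simp only: exp_add weight_def mult_ac)
  finally show ?thesis by (simp add: algebra_simps)
qed

text \<open>The Gaussian factor absorbs quartic growth and leaves a constant multiple of
  \<open>p\<close>. Order four is needed for the remainder in the second moment estimate.\<close>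

lemma integrable_weight_scaleR:
  fixes b :: "'a \<Rightarrow> 'b::{banach, second_countable_topology}"
  assumes "0 < s" and [measurable]: "b \<in> borel_measurable borel"
    and b: "\<And>x. norm (b x) \<le> C * (1 + norm (x - m) ^ 4)"
  shows "integrable lborel (\<lambda>x. weight s z x *\<^sub>R b x)"
proof (rule Bochner_Integration.integrable_bound)
  \<comment> \<open>\<open>E\<close> bounds \<open>1 + norm (x - m) ^ 4\<close> times the Gaussian
    factor. Its part in \<open>s\<close> comes from bounding the square of
    \<open>r / (2 * s)\<close> by twice its exponential.\<close>
  define E where "E = 1 + 64 * s\<^sup>2 + 8 * norm (z - m) ^ 4"
  have "0 \<le> C * (1 + norm (x - m) ^ 4)" for x using b norm_ge_zero order_trans by blast
  from this[of m] have "0 \<le> C" by simp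
  show "integrable lborel (\<lambda>x. p x * (C * E))" using p_int by simp
  have "norm (weight s z x *\<^sub>R b x) \<le> norm (p x * (C * E))" for x
  proof -
    define r where "r = (norm (z - x))\<^sup>2"
    have "(norm (x - m))\<^sup>2 \<le> 2 * r + 2 * (norm (z - m))\<^sup>2"
      using norm_add_power2_le[of "x - z" "z - m"] by (simp add: r_def norm_minus_commute)
    then have "((norm (x - m))\<^sup>2)\<^sup>2 \<le> (2 * r + 2 * (norm (z - m))\<^sup>2)\<^sup>2" by (intro power_mono) auto
    also have "\<dots> \<le> 8 * r\<^sup>2 + 8 * ((norm (z - m))\<^sup>2)\<^sup>2"
      using zero_le_power2[of "r - (norm (z - m))\<^sup>2"] by (simp add: power2_eq_square algebra_simps)
    finally have m4: "norm (x - m) ^ 4 \<le> 8 * r\<^sup>2 + 8 * norm (z - m) ^ 4" by simp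
    have "0 \<le> r / (2 * s)" using \<open>0 < s\<close> by (simp add: r_def)
    then have ex: "1 \<le> exp (r / (2 * s))" by simp
    have "(r / (2 * s))\<^sup>2 / 2 \<le> exp (r / (2 * s))"
      using exp_lower_Taylor_quadratic[OF \<open>0 \<le> r / (2 * s)\<close>] \<open>0 \<le> r / (2 * s)\<close> by linarith
    then have ex2: "8 * r\<^sup>2 \<le> 64 * s\<^sup>2 * exp (r / (2 * s))"
      using \<open>0 < s\<close> by (simp add: field_simps power2_eq_square)
    have "1 + norm (x - m) ^ 4 \<le> 1 + (8 * r\<^sup>2 + 8 * norm (z - m) ^ 4)" using m4 by simp
    also have "\<dots> \<le> exp (r / (2 * s)) + (64 * s\<^sup>2 * exp (r / (2 * s)) + 8 * norm (z - m) ^ 4 * exp (r / (2 * s)))"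
      using ex ex2 mult_left_mono[OF ex, of "8 * norm (z - m) ^ 4"] by (intro add_mono) auto
    finally have "1 + norm (x - m) ^ 4 \<le> E * exp (r / (2 * s))" by (simp add: E_def algebra_simps)
    then have "exp (- r / (2 * s)) * (1 + norm (x - m) ^ 4) \<le> E"
      by (simp add: exp_minus field_simps)
    then have *: "C * (exp (- r / (2 * s)) * (1 + norm (x - m) ^ 4)) \<le> C * E"
      using \<open>0 \<le> C\<close> by (rule mult_left_mono)
    have "norm (weight s z x *\<^sub>R b x) = p x * exp (- r / (2 * s)) * norm (b x)"
      using p_pos[of x] by (simp add: weight_def r_def abs_mult)
    also have "\<dots> \<le> p x * exp (- r / (2 * s)) * (C * (1 + norm (x - m) ^ 4))"
      using b p_pos[of x] by (intro mult_left_mono) auto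
    also have "\<dots> = p x * (C * (exp (- r / (2 * s)) * (1 + norm (x - m) ^ 4)))" by simp
    also have "\<dots> \<le> p x * (C * E)" by (rule mult_left_mono[OF * less_imp_le[OF p_pos]])
    also have "\<dots> \<le> norm (p x * (C * E))" by simp
    finally show ?thesis .
  qed
  then show "AE x in lborel. norm (weight s z x *\<^sub>R b x) \<le> norm (p x * (C * E))" by simp
qed simp

lemma integrable_weight:
  assumes "0 < s" shows "integrable lborel (weight s z)"
  using integrable_weight_scaleR[OF assms, of "\<lambda>_. 1 :: real" 1 0 z] by simp

lemma integrable_weight_vector:
  assumes "0 < s" shows "integrable lborel (\<lambda>x. weight s z x *\<^sub>R (x - m))"
proof (rule integrable_weight_scaleR[OF assms, where C = 1 and m = m])
  fix x
  show "norm (x - m) \<le> 1 * (1 + norm (x - m) ^ 4)"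
    using self_le_power[of "norm (x - m)" 4] by (cases "norm (x - m) \<le> 1") (auto intro: add_increasing2)
qed simp

lemma integrable_weight_sq:
  assumes "0 < s" shows "integrable lborel (\<lambda>x. weight s z x * (norm (x - m))\<^sup>2)"
proof -
  have "(norm (x - m))\<^sup>2 \<le> 1 + norm (x - m) ^ 4" for x
  proof -
    have "a \<le> 1 + a\<^sup>2" if "0 \<le> a" for a :: real
      using zero_le_power2[of "a - 1"] that by (simp add: power2_eq_square algebra_simps)
    from this[of "(norm (x - m))\<^sup>2"] show ?thesis by simp
  qed
  then show ?thesis
    using integrable_weight_scaleR[OF assms, of "\<lambda>x. (norm (x - m))\<^sup>2" 1 m z] by simp
qed

lemma integrable_weight_pow4:
  assumes "0 < s" shows "integrable lborel (\<lambda>x. weight s z x * norm (x - m) ^ 4)"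
  using integrable_weight_scaleR[OF assms, of "\<lambda>x. norm (x - m) ^ 4" 1 m z] by simp

lemma integral_weight_pos:
  assumes "0 < s" shows "0 < (\<integral>x. weight s z x \<partial>lborel)"
proof -
  have "(\<integral>x. weight s z x \<partial>lborel) \<noteq> 0"
    using integral_nonneg_eq_0_iff_AE[OF integrable_weight[OF assms, of z]] weight_pos[of s z]
    by (simp add: less_imp_le less_imp_neq[THEN not_sym] eventually_False ae_filter_eq_bot_iff)
  moreover have "0 \<le> (\<integral>x. weight s z x \<partial>lborel)"
    by (rule Bochner_Integration.integral_nonneg) (rule less_imp_le[OF weight_pos])
  ultimately show ?thesis by simp
qed

text \<open>By stationarity of \<open>m\<close> and monotonicity of \<open>g\<close>, the gradient
  of the posterior potential at \<open>x\<close>, paired with \<open>x - m\<close>, is at least the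
  squared distance to \<open>m\<close> divided by \<open>s\<close>. The tangent inequality at
  \<open>x\<close> turns this into decay along the ray from the mode.\<close>

lemma weight_dilation:
  assumes "0 < s" and m: "m + s *\<^sub>R g m = z" and "0 \<le> t"
  shows "weight s z (m + (1 + t) *\<^sub>R (x - m)) \<le> weight s z x * exp (- (t * ((norm (x - m))\<^sup>2 / s)))"
proof -
  define y where "y = m + (1 + t) *\<^sub>R (x - m)"
  have y: "y - x = t *\<^sub>R (x - m)" by (simp add: y_def algebra_simps)
  have "weight s z y \<le> weight s z x
    * exp (- (g x \<bullet> (y - x)) - (x - z) \<bullet> (y - x) / s - (norm (y - x))\<^sup>2 / (2 * s))"
    by (rule weight_tangent[OF \<open>0 < s\<close>])
  also have "\<dots> \<le> weight s z x * exp (- (t * ((norm (x - m))\<^sup>2 / s)))"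
  proof -
    have "(x - z) \<bullet> (x - m) / s = (norm (x - m))\<^sup>2 / s - g m \<bullet> (x - m)"
      using \<open>0 < s\<close> unfolding m[symmetric] by (simp add: power2_norm_eq_inner inner_simps field_simps)
    moreover have "0 \<le> (g x - g m) \<bullet> (x - m)" by (rule g_mono)
    ultimately have "(norm (x - m))\<^sup>2 / s \<le> g x \<bullet> (x - m) + (x - z) \<bullet> (x - m) / s"
      by (simp add: inner_simps)
    then have "t * ((norm (x - m))\<^sup>2 / s) \<le> t * (g x \<bullet> (x - m) + (x - z) \<bullet> (x - m) / s)"
      using \<open>0 \<le> t\<close> by (rule mult_left_mono)
    also have "\<dots> = g x \<bullet> (y - x) + (x - z) \<bullet> (y - x) / s"
      unfolding y by (simp add: algebra_simps)
    finally have "t * ((norm (x - m))\<^sup>2 / s) \<le> g x \<bullet> (y - x) + (x - z) \<bullet> (y - x) / s" .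
    moreover have "0 \<le> (norm (y - x))\<^sup>2 / (2 * s)" using \<open>0 < s\<close> by simp
    ultimately show ?thesis using weight_pos[of s z x] by (intro mult_left_mono) auto
  qed
  finally show ?thesis by (simp add: y_def)
qed

text \<open>Comparing the total mass with that of the dilation about the mode replaces the integration by
  parts that shows \<open>E[(X - m) \<bullet> \<nabla>V(X)] = d\<close> for the potential \<open>V\<close> of the posterior.\<close>

lemma weight_second_moment:
  assumes "0 < s" and m: "m + s *\<^sub>R g m = z"
  shows "(\<integral>x. weight s z x * (norm (x - m))\<^sup>2 \<partial>lborel) \<le> real DIM('a) * s * (\<integral>x. weight s z x \<partial>lborel)"
proof -
  let ?d = "real DIM('a)"
  define Z where "Z = (\<integral>x. weight s z x \<partial>lborel)"
  define S2 where "S2 = (\<integral>x. weight s z x * (norm (x - m))\<^sup>2 \<partial>lborel)"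
  define S4 where "S4 = (\<integral>x. weight s z x * norm (x - m) ^ 4 \<partial>lborel)"
  note int = integrable_weight[OF \<open>0 < s\<close>, of z] integrable_weight_sq[OF \<open>0 < s\<close>, of z m]
    integrable_weight_pow4[OF \<open>0 < s\<close>, of z m]
  have "0 < Z" unfolding Z_def by (rule integral_weight_pos[OF \<open>0 < s\<close>])
  \<comment> \<open>Stretching by \<open>1 + t\<close> and dividing by \<open>t\<close> leaves the
    fourth moment with a factor \<open>t\<close>, so it disappears as \<open>t\<close> tends to
    0.\<close>
  have bound: "S2 / s \<le> ?d * Z + t * (S4 / (2 * s\<^sup>2))" if t: "0 < t" "t < 1" for t
  proof -
    have "(\<integral>x. weight s z (- t *\<^sub>R m + (1 + t) *\<^sub>R x) \<partial>lborel)
        \<le> (\<integral>x. weight s z x - t / s * (weight s z x * (norm (x - m))\<^sup>2)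
               + t\<^sup>2 / (2 * s\<^sup>2) * (weight s z x * norm (x - m) ^ 4) \<partial>lborel)"
    proof (rule integral_mono)
      show "integrable lborel (\<lambda>x. weight s z (- t *\<^sub>R m + (1 + t) *\<^sub>R x))"
        using t by (intro integrable_lborel_affine int) auto
      show "integrable lborel (\<lambda>x. weight s z x - t / s * (weight s z x * (norm (x - m))\<^sup>2)
               + t\<^sup>2 / (2 * s\<^sup>2) * (weight s z x * norm (x - m) ^ 4))"
        by (intro Bochner_Integration.integrable_add Bochner_Integration.integrable_diff
            integrable_mult_right int)
      fix x
      have "- t *\<^sub>R m + (1 + t) *\<^sub>R x = m + (1 + t) *\<^sub>R (x - m)" by (simp add: algebra_simps)
      then have "weight s z (- t *\<^sub>R m + (1 + t) *\<^sub>R x)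
          \<le> weight s z x * exp (- (t * ((norm (x - m))\<^sup>2 / s)))"
        using weight_dilation[OF assms, of t x] t by simp
      also have "\<dots> \<le> weight s z x
          * (1 - t * ((norm (x - m))\<^sup>2 / s) + (t * ((norm (x - m))\<^sup>2 / s))\<^sup>2 / 2)"
        using weight_pos[of s z x] t \<open>0 < s\<close> by (intro mult_left_mono exp_minus_le_quadratic) auto
      also have "\<dots> = weight s z x - t / s * (weight s z x * (norm (x - m))\<^sup>2)
               + t\<^sup>2 / (2 * s\<^sup>2) * (weight s z x * norm (x - m) ^ 4)"
        by (simp add: power_mult_distrib power_divide algebra_simps)
      finally show "weight s z (- t *\<^sub>R m + (1 + t) *\<^sub>R x)
        \<le> weight s z x - t / s * (weight s z x * (norm (x - m))\<^sup>2)
               + t\<^sup>2 / (2 * s\<^sup>2) * (weight s z x * norm (x - m) ^ 4)" .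
    qed
    also have "\<dots> = Z - t / s * S2 + t\<^sup>2 / (2 * s\<^sup>2) * S4"
      using int by (simp add: Z_def S2_def S4_def)
    finally have le: "(\<integral>x. weight s z (- t *\<^sub>R m + (1 + t) *\<^sub>R x) \<partial>lborel)
        \<le> Z - t / s * S2 + t\<^sup>2 / (2 * s\<^sup>2) * S4" .
    have eq: "Z = (1 + t) ^ DIM('a) * (\<integral>x. weight s z (- t *\<^sub>R m + (1 + t) *\<^sub>R x) \<partial>lborel)"
      unfolding Z_def using t by (intro integral_lborel_affine) auto
    \<comment> \<open>Dilation divides the mass by \<open>(1 + t) ^ DIM('a)\<close>. The power of
      \<open>1 - t\<close> is a lower bound for the reciprocal, and Bernoulli's inequality
      linearises it.\<close>
    have "1 - ?d * t \<le> (1 - t) ^ DIM('a)"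
      using Bernoulli_inequality[of "- t" "DIM('a)"] t by simp
    moreover have "(1 - t) ^ DIM('a) * (1 + t) ^ DIM('a) \<le> 1"
      using t by (subst power_mult_distrib[symmetric], intro power_le_one)
        (auto simp: algebra_simps mult_le_one)
    ultimately have "(1 - ?d * t) * Z \<le> (1 - t) ^ DIM('a) * Z"
      using \<open>0 < Z\<close> by (intro mult_right_mono) auto
    also have "\<dots> \<le> (\<integral>x. weight s z (- t *\<^sub>R m + (1 + t) *\<^sub>R x) \<partial>lborel)"
    proof -
      have "0 \<le> (\<integral>x. weight s z (- t *\<^sub>R m + (1 + t) *\<^sub>R x) \<partial>lborel)"
        by (rule Bochner_Integration.integral_nonneg) (rule less_imp_le[OF weight_pos])
      then show ?thesis
        using mult_right_mono[OF \<open>(1 - t) ^ DIM('a) * (1 + t) ^ DIM('a) \<le> 1\<close>]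
        by (subst eq) (simp add: mult.assoc)
    qed
    also note le
    finally have "t * (S2 / s) \<le> t * (?d * Z + t * (S4 / (2 * s\<^sup>2)))"
      by (simp add: algebra_simps power2_eq_square)
    then show ?thesis using t(1) by (simp only: mult_le_cancel_left_pos)
  qed
  have "((\<lambda>t. ?d * Z + t * (S4 / (2 * s\<^sup>2))) \<longlongrightarrow> ?d * Z + 0 * (S4 / (2 * s\<^sup>2))) (at_right 0)"
    by (intro tendsto_intros)
  moreover have "eventually (\<lambda>t. S2 / s \<le> ?d * Z + t * (S4 / (2 * s\<^sup>2))) (at_right 0)"
    unfolding eventually_at_right_field using bound by (intro exI[of _ 1]) auto
  ultimately have "S2 / s \<le> ?d * Z"
    using tendsto_lowerbound by fastforce
  then show ?thesis using \<open>0 < s\<close> by (simp add: S2_def Z_def field_simps)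
qed

text \<open>The tangent inequality based at the shifted point bounds the shifted weight below by
  \<open>weight s z x * exp (- (t * N))\<close>, and the exponential lies above its tangent.
  Expanding \<open>N\<close> about the mode isolates a part linear in \<open>x - m\<close>; the rest
  is the Hessian remainder and terms of higher order in \<open>t\<close>.\<close>

lemma weight_translation:
  assumes "0 < s" and m: "m + s *\<^sub>R g m = z" and "0 \<le> t"
  shows "weight s z x * (1 - t * (H m (x - m) \<bullet> h + (x - m) \<bullet> h / s + t * (H m h \<bullet> h + (norm h)\<^sup>2 / s)
      + K * norm h * (2 * (norm (x - m))\<^sup>2 + 2 * t\<^sup>2 * (norm h)\<^sup>2)))
    \<le> weight s z (t *\<^sub>R h + 1 *\<^sub>R x)"
proof -
  define y where "y = x + t *\<^sub>R h"
  \<comment> \<open>The slope of the posterior potential at \<open>y\<close> in direction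
    \<open>h\<close>. Stationarity makes the slope at \<open>m\<close> zero, so it can be
    subtracted.\<close>
  define N where "N = g y \<bullet> h + (y - z) \<bullet> h / s"
  have "N = (g y - g m) \<bullet> h + (y - m) \<bullet> h / s"
    using \<open>0 < s\<close> unfolding N_def m[symmetric] by (simp add: inner_simps field_simps)
  also have "(g y - g m) \<bullet> h = H m (y - m) \<bullet> h + (g y - g m - H m (y - m)) \<bullet> h"
    by (simp add: inner_simps)
  also have "(g y - g m - H m (y - m)) \<bullet> h \<le> norm (g y - g m - H m (y - m)) * norm h"
    by (rule norm_cauchy_schwarz)
  also have "\<dots> \<le> (K * (norm (y - m))\<^sup>2) * norm h"
    by (intro mult_right_mono g_taylor) simp
  also have "\<dots> \<le> (K * (2 * (norm (x - m))\<^sup>2 + 2 * (norm (t *\<^sub>R h))\<^sup>2)) * norm h"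
    using norm_add_power2_le[of "x - m" "t *\<^sub>R h"] K_nonneg
    by (intro mult_right_mono mult_left_mono) (auto simp: y_def algebra_simps)
  finally have "N \<le> H m (y - m) \<bullet> h + (y - m) \<bullet> h / s
      + K * norm h * (2 * (norm (x - m))\<^sup>2 + 2 * t\<^sup>2 * (norm h)\<^sup>2)"
    by (simp add: power_mult_distrib mult_ac)
  also have "y - m = (x - m) + t *\<^sub>R h" by (simp add: y_def)
  also have "H m ((x - m) + t *\<^sub>R h) = H m (x - m) + t *\<^sub>R H m h"
    by (simp add: linear_add[OF linear_H] linear_cmul[OF linear_H])
  finally have N: "N \<le> H m (x - m) \<bullet> h + (x - m) \<bullet> h / s + t * (H m h \<bullet> h + (norm h)\<^sup>2 / s)
      + K * norm h * (2 * (norm (x - m))\<^sup>2 + 2 * t\<^sup>2 * (norm h)\<^sup>2)" (is "_ \<le> ?B")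
    by (simp add: inner_add_left inner_diff_left power2_norm_eq_inner add_divide_distrib diff_divide_distrib
        ring_distribs)
  have "weight s z x \<le> weight s z y
    * exp (- (g y \<bullet> (x - y)) - (y - z) \<bullet> (x - y) / s - (norm (x - y))\<^sup>2 / (2 * s))"
    by (rule weight_tangent[OF \<open>0 < s\<close>])
  also have "\<dots> \<le> weight s z y * exp (t * N)"
  proof -
    have "x - y = - t *\<^sub>R h" by (simp add: y_def)
    then have "- (g y \<bullet> (x - y)) - (y - z) \<bullet> (x - y) / s = t * N"
      by (simp only: N_def inner_scaleR_right) (simp add: ring_distribs)
    moreover have "0 \<le> (norm (x - y))\<^sup>2 / (2 * s)" using \<open>0 < s\<close> by simp
    ultimately show ?thesis using weight_pos[of s z y] by (intro mult_left_mono) auto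
  qed
  finally have W: "weight s z x \<le> weight s z y * exp (t * N)" .
  have "1 - t * ?B \<le> 1 - t * N" using N \<open>0 \<le> t\<close> by (simp add: mult_left_mono)
  also have "\<dots> \<le> exp (- (t * N))" using exp_ge_add_one_self[of "- (t * N)"] by simp
  finally have "weight s z x * (1 - t * ?B) \<le> weight s z x * exp (- (t * N))"
    using weight_pos[of s z x] by (intro mult_left_mono) auto
  also have "\<dots> \<le> weight s z y" using W by (simp add: exp_minus field_simps)
  finally show ?thesis by (simp add: y_def add.commute)
qed

text \<open>Translation invariance plays the role of \<open>E[\<nabla>V(X)] = 0\<close>.\<close>

lemma weight_first_moment:
  assumes "0 < s" and m: "m + s *\<^sub>R g m = z"
  shows "norm (\<integral>x. weight s z x *\<^sub>R (x - m) \<partial>lborel)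
    \<le> 2 * K * real DIM('a) * s\<^sup>2 * (\<integral>x. weight s z x \<partial>lborel)"
proof -
  define Z where "Z = (\<integral>x. weight s z x \<partial>lborel)"
  define S2 where "S2 = (\<integral>x. weight s z x * (norm (x - m))\<^sup>2 \<partial>lborel)"
  define B where "B = (\<integral>x. weight s z x *\<^sub>R (x - m) \<partial>lborel)"
  \<comment> \<open>Shifting against \<open>B\<close> makes \<open>l B\<close> equal to minus a
    quadratic form in \<open>B\<close>: the Hessian part is nonnegative and the Gaussian part is the
    square of \<open>norm B\<close> over \<open>s\<close>. Hence \<open>l B\<close> controls
    \<open>norm B\<close>.\<close>
  define h where "h = - B"
  define l where "l y = H m y \<bullet> h + y \<bullet> h / s" for y
  define c where "c = H m h \<bullet> h + (norm h)\<^sup>2 / s"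
  have "0 < Z" unfolding Z_def by (rule integral_weight_pos[OF \<open>0 < s\<close>])
  note int = integrable_weight[OF \<open>0 < s\<close>, of z] integrable_weight_sq[OF \<open>0 < s\<close>, of z m]
    integrable_weight_vector[OF \<open>0 < s\<close>, of z m]
  have "linear l"
    by (rule linearI)
      (simp_all add: l_def linear_add[OF linear_H] linear_cmul[OF linear_H] inner_simps
        add_divide_distrib algebra_simps)
  then have bl: "bounded_linear l" by (simp add: linear_linear)
  have "l (weight s z x *\<^sub>R (x - m)) = weight s z x * l (x - m)" for x
    by (simp add: linear_cmul[OF \<open>linear l\<close>])
  then have l_int: "integrable lborel (\<lambda>x. weight s z x * l (x - m))"
      "(\<integral>x. weight s z x * l (x - m) \<partial>lborel) = l B"
    using integrable_bounded_linear[OF bl int(3)] integral_bounded_linear[OF bl int(3)]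
    by (simp_all add: B_def)
  \<comment> \<open>Both integrals have mass \<open>Z\<close>, so the terms of order zero cancel.
    After division by \<open>t\<close>, the limit at 0 keeps only the first-order terms.\<close>
  have bound: "0 \<le> l B + 2 * K * norm h * S2 + t * (c * Z) + 2 * t\<^sup>2 * K * norm h ^ 3 * Z" if "0 < t" for t
  proof -
    let ?e = "2 * t\<^sup>2 * K * norm h ^ 3"
    have "(\<integral>x. (1 - t * (t * c + ?e)) * weight s z x - t * (weight s z x * l (x - m))
            - (2 * t * K * norm h) * (weight s z x * (norm (x - m))\<^sup>2) \<partial>lborel)
        \<le> (\<integral>x. weight s z (t *\<^sub>R h + 1 *\<^sub>R x) \<partial>lborel)"
    proof (rule integral_mono)
      show "integrable lborel (\<lambda>x. (1 - t * (t * c + ?e)) * weight s z x - t * (weight s z x * l (x - m))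
            - (2 * t * K * norm h) * (weight s z x * (norm (x - m))\<^sup>2))"
        by (intro Bochner_Integration.integrable_diff integrable_mult_right int l_int)
      show "integrable lborel (\<lambda>x. weight s z (t *\<^sub>R h + 1 *\<^sub>R x))"
        by (intro integrable_lborel_affine int) auto
      fix x
      show "(1 - t * (t * c + ?e)) * weight s z x - t * (weight s z x * l (x - m))
            - (2 * t * K * norm h) * (weight s z x * (norm (x - m))\<^sup>2) \<le> weight s z (t *\<^sub>R h + 1 *\<^sub>R x)"
        using weight_translation[OF assms, of t x h] \<open>0 < t\<close>
        by (simp add: l_def c_def algebra_simps power2_eq_square power3_eq_cube)
    qed
    also have "\<dots> = Z"
      unfolding Z_def by (subst integral_lborel_affine[where c = 1 and t = "t *\<^sub>R h"]) auto
    finally have "(1 - t * (t * c + ?e)) * Z - t * l B - (2 * t * K * norm h) * S2 \<le> Z"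
      using int l_int by (simp add: Z_def S2_def)
    then have "t * 0 \<le> t * (l B + 2 * K * norm h * S2 + t * (c * Z) + ?e * Z)"
      by (simp add: algebra_simps)
    then show ?thesis using \<open>0 < t\<close> by (simp only: mult_le_cancel_left_pos)
  qed
  have "((\<lambda>t. l B + 2 * K * norm h * S2 + t * (c * Z) + 2 * t\<^sup>2 * K * norm h ^ 3 * Z) \<longlongrightarrow>
      l B + 2 * K * norm h * S2 + 0 * (c * Z) + 2 * 0\<^sup>2 * K * norm h ^ 3 * Z) (at_right 0)"
    by (intro tendsto_intros)
  moreover have "eventually (\<lambda>t. 0 \<le> l B + 2 * K * norm h * S2 + t * (c * Z)
      + 2 * t\<^sup>2 * K * norm h ^ 3 * Z) (at_right 0)"
    unfolding eventually_at_right_field using bound by (intro exI[of _ 1]) auto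
  ultimately have lim: "0 \<le> l B + 2 * K * norm h * S2"
    using tendsto_lowerbound by fastforce
  have "l B \<le> - ((norm B)\<^sup>2 / s)"
    using H_nonneg[of m B] by (simp add: l_def h_def power2_norm_eq_inner)
  with lim have "(norm B)\<^sup>2 / s \<le> 2 * K * norm B * S2" by (simp add: h_def)
  also have "\<dots> \<le> 2 * K * norm B * (real DIM('a) * s * Z)"
    unfolding S2_def Z_def using K_nonneg by (intro mult_left_mono weight_second_moment assms) auto
  finally have "norm B * norm B \<le> norm B * (2 * K * real DIM('a) * s\<^sup>2 * Z)"
    using \<open>0 < s\<close> by (simp add: field_simps power2_eq_square)
  moreover have "0 \<le> 2 * K * real DIM('a) * s\<^sup>2 * Z" using K_nonneg \<open>0 < Z\<close> by simp
  ultimately show ?thesis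
    unfolding B_def[symmetric] Z_def[symmetric]
    by (cases "norm B = 0") (auto simp: mult_le_cancel_left)
qed

lemma MMSE_eq:
  assumes "0 < s"
  shows "MMSE p (sqrt s) z = (1 / (\<integral>x. weight s z x \<partial>lborel)) *\<^sub>R (\<integral>x. weight s z x *\<^sub>R x \<partial>lborel)"
proof -
  define a where "a = (2 * pi * s) powr (- real DIM('a) / 2)"
  have "0 < a" using assms by (simp add: a_def)
  have "p x * gauss_density (sqrt s) (z - x) = a * weight s z x" for x
    using assms by (simp add: gauss_density_def weight_def a_def)
  then show ?thesis
    using \<open>0 < a\<close>
    by (simp add: MMSE_def smoothed_density_def flip: scaleR_scaleR) (simp add: divide_inverse)
qed

text \<open>The proximal point is the mode of the posterior, so this is the first moment bound
  divided by the total mass. The constant does not depend on \<open>z\<close>.\<close>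

lemma MMSE_prox_dist:
  assumes "0 < s"
  shows "norm (MMSE p (sqrt s) z - prox_neglog s p z) \<le> 2 * K * real DIM('a) * s\<^sup>2"
proof -
  define m where "m = prox_neglog s p z"
  define Z where "Z = (\<integral>x. weight s z x \<partial>lborel)"
  have "0 < Z" unfolding Z_def by (rule integral_weight_pos[OF assms])
  have "(\<integral>x. weight s z x *\<^sub>R x \<partial>lborel)
      = (\<integral>x. weight s z x *\<^sub>R (x - m) + weight s z x *\<^sub>R m \<partial>lborel)"
    by (simp add: algebra_simps)
  also have "\<dots> = (\<integral>x. weight s z x *\<^sub>R (x - m) \<partial>lborel) + Z *\<^sub>R m"
    unfolding Z_def
    using integrable_weight_vector[OF assms, of z m] integrable_weight[OF assms, of z]
    by (subst Bochner_Integration.integral_add) auto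
  finally have "MMSE p (sqrt s) z - m = (1 / Z) *\<^sub>R (\<integral>x. weight s z x *\<^sub>R (x - m) \<partial>lborel)"
    using \<open>0 < Z\<close> by (simp add: MMSE_eq[OF assms] Z_def[symmetric] scaleR_add_right)
  then have "norm (MMSE p (sqrt s) z - m) = norm (\<integral>x. weight s z x *\<^sub>R (x - m) \<partial>lborel) / Z"
    using \<open>0 < Z\<close> by simp
  also have "\<dots> \<le> 2 * K * real DIM('a) * s\<^sup>2"
    using weight_first_moment[OF assms prox_equation[OF assms, of z]] \<open>0 < Z\<close>
    by (simp add: m_def Z_def field_simps)
  finally show ?thesis by (simp add: m_def)
qed

end

section \<open>The inner iteration\<close>

text \<open>The sequence \<open>harm n - ln n\<close> decreases from its first value 1. The shift
  inside the logarithm covers \<open>n = 0\<close>.\<close>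

lemma harm_le_ln: "harm n \<le> 1 + ln (real n + 1)"
proof (cases "n = 0")
  case False
  then have "harm n - ln (real n) \<le> 1"
    using euler_mascheroni_sequence_decreasing[of 1 n] by (simp add: harm_def)
  moreover have "ln (real n) \<le> ln (real n + 1)" using False by simp
  ultimately show ?thesis by linarith
qed (simp add: harm_def)

text \<open>Half of the excess exponent \<eta> is spent on absorbing the logarithm; the other half
  keeps the series convergent.\<close>

lemma summable_ln_over_powr:
  assumes "0 < (\<eta>::real)"
  shows "summable (\<lambda>k. (1 + ln (real k)) / real k powr (1 + \<eta>))"
proof (rule summable_comparison_test)
  show "summable (\<lambda>k. (1 + 2 / \<eta>) * real k powr (- (1 + \<eta> / 2)))"
    using assms by (intro summable_mult) (subst summable_real_powr_iff, simp)
  have "norm ((1 + ln (real k)) / real k powr (1 + \<eta>)) \<le> (1 + 2 / \<eta>) * real k powr (- (1 + \<eta> / 2))"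
    if "1 \<le> k" for k
  proof -
    have k: "1 \<le> real k" using that by simp
    have "ln (real k) \<le> real k powr (\<eta> / 2) / (\<eta> / 2)"
      using k assms by (intro ln_powr_bound) auto
    moreover have "1 \<le> real k powr (\<eta> / 2)" using k assms by (simp add: ge_one_powr_ge_zero)
    ultimately have "1 + ln (real k) \<le> (1 + 2 / \<eta>) * real k powr (\<eta> / 2)"
      by (simp add: algebra_simps)
    then have "(1 + ln (real k)) / real k powr (1 + \<eta>)
        \<le> ((1 + 2 / \<eta>) * real k powr (\<eta> / 2)) / real k powr (1 + \<eta>)"
      by (rule divide_right_mono) simp
    also have "\<dots> = (1 + 2 / \<eta>) * real k powr (\<eta> / 2 - (1 + \<eta>))"
      by (simp only: powr_diff times_divide_eq_right)
    also have "\<eta> / 2 - (1 + \<eta>) = - (1 + \<eta> / 2)" by simp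
    finally show ?thesis using k by simp
  qed
  then show "\<exists>N. \<forall>k\<ge>N. norm ((1 + ln (real k)) / real k powr (1 + \<eta>))
      \<le> (1 + 2 / \<eta>) * real k powr (- (1 + \<eta> / 2))" by blast
qed

text \<open>The floor gives \<open>n \<le> c * P \<le> n + 1\<close>: the first bound controls the
  logarithm, the second the denominator. The \<open>+ 1\<close> also covers an empty inner
  loop.\<close>

lemma n_iter_rate:
  assumes "0 < c" "0 < \<eta>" "1 \<le> k"
  shows "(1 + harm (n_iter c \<eta> k)) / (real (n_iter c \<eta> k) + 1)
    \<le> (3 + ln (c + 1) + \<eta>) / c * ((1 + ln (real k)) / real k powr (1 + \<eta>))"
proof -
  define n where "n = n_iter c \<eta> k"
  define P where "P = real k powr (1 + \<eta>)"
  have k: "1 \<le> real k" using assms by simp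
  have P: "1 \<le> P" using k assms unfolding P_def by (intro ge_one_powr_ge_zero) auto
  have "0 \<le> c * P" using assms P by simp
  then have n: "real n \<le> c * P" "c * P \<le> real n + 1"
    unfolding n_def n_iter_def P_def by linarith+
  have "1 + harm n \<le> 2 + ln (real n + 1)" using harm_le_ln[of n] by simp
  also have "ln (real n + 1) \<le> ln ((c + 1) * P)"
    using n P assms by (subst ln_le_cancel_iff) (auto simp: algebra_simps intro: add_pos_pos)
  also have "\<dots> = ln (c + 1) + (1 + \<eta>) * ln (real k)"
    using P assms k by (subst ln_mult) (auto simp: P_def ln_powr)
  also have "2 + (ln (c + 1) + (1 + \<eta>) * ln (real k)) \<le> (3 + ln (c + 1) + \<eta>) * (1 + ln (real k))"
  proof -
    have "0 \<le> (2 + ln (c + 1)) * ln (real k)" using k assms by simp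
    then show ?thesis using assms by (simp add: algebra_simps)
  qed
  finally have "(1 + harm n) / (real n + 1) \<le> (3 + ln (c + 1) + \<eta>) * (1 + ln (real k)) / (c * P)"
    using n assms P k by (intro frac_le) (auto intro!: mult_nonneg_nonneg add_nonneg_nonneg)
  then show ?thesis by (simp add: n_def P_def)
qed

section \<open>Recursions for the inner iterates\<close>

context smooth_logconcave
begin

lemma inner_z_Suc:
  "inner_z p \<tau> u (Suc i) = ((real i + 1) / (real i + 2)) *\<^sub>R MMSE p (sqrt (\<tau> / (real i + 1))) (inner_z p \<tau> u i)
     + (1 / (real i + 2)) *\<^sub>R u"
proof -
  have "1 - (real i + 1) / (real i + 2) = 1 / (real i + 2)" by (simp add: field_simps)
  then show ?thesis by (simp add: Let_def)
qed

text \<open>Multiplied by \<open>i + 2\<close>, the recursion telescopes. Replacing the two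
  posterior means by proximal points costs a multiple of \<open>(i + 1) * s\<^sup>2\<close>, which
  is \<open>\<tau>\<^sup>2 / (i + 1)\<close> and sums to a harmonic number. The constant is
  independent of \<open>u\<close> and \<open>v\<close>.\<close>

lemma inner_z_stable:
  assumes "0 < \<tau>"
  shows "(real n + 1) * norm (inner_z p \<tau> u n - inner_z p \<tau> v n)
    \<le> (real n + 1) * norm (u - v) + 4 * K * real DIM('a) * \<tau>\<^sup>2 * harm n"
proof (induction n)
  case 0
  show ?case by (simp add: harm_def)
next
  case (Suc i)
  define s where "s = \<tau> / (real i + 1)"
  define a b where "a = inner_z p \<tau> u i" and "b = inner_z p \<tau> v i"
  define Q where "Q = prox_neglog s p"
  define N where "N = MMSE p (sqrt s)"
  have "0 < s" using assms by (simp add: s_def)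
  have NQ: "norm (N w - Q w) \<le> 2 * K * real DIM('a) * s\<^sup>2" for w
    unfolding N_def Q_def by (rule MMSE_prox_dist[OF \<open>0 < s\<close>])
  have "N a - N b = (N a - Q a) + (Q a - Q b) + (Q b - N b)" by simp
  then have "norm (N a - N b) \<le> norm (N a - Q a) + norm (Q a - Q b) + norm (Q b - N b)"
    using norm_triangle_le[OF add_right_mono[OF norm_triangle_ineq]] by (metis order_refl)
  also have "\<dots> \<le> 2 * K * real DIM('a) * s\<^sup>2 + norm (a - b) + 2 * K * real DIM('a) * s\<^sup>2"
    using NQ[of a] NQ[of b] prox_nonexpansive[OF \<open>0 < s\<close>, of a b]
    by (simp add: Q_def norm_minus_commute)
  finally have N: "norm (N a - N b) \<le> norm (a - b) + 4 * K * real DIM('a) * s\<^sup>2" by simp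
  have "(real i + 2) *\<^sub>R (inner_z p \<tau> u (Suc i) - inner_z p \<tau> v (Suc i))
      = (real i + 1) *\<^sub>R (N a - N b) + (u - v)"
    unfolding inner_z_Suc by (simp add: N_def s_def a_def b_def scaleR_add_right scaleR_diff_right)
  then have "(real i + 2) * norm (inner_z p \<tau> u (Suc i) - inner_z p \<tau> v (Suc i))
      = norm ((real i + 1) *\<^sub>R (N a - N b) + (u - v))"
    by (metis abs_of_nonneg add_nonneg_nonneg norm_scaleR of_nat_0_le_iff zero_le_numeral)
  also have "\<dots> \<le> (real i + 1) * norm (N a - N b) + norm (u - v)"
    by (rule order_trans[OF norm_triangle_ineq]) simp
  also have "(real i + 1) * norm (N a - N b) \<le> (real i + 1) * (norm (a - b) + 4 * K * real DIM('a) * s\<^sup>2)"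
    using N by (intro mult_left_mono) auto
  also have "\<dots> = (real i + 1) * norm (a - b) + 4 * K * real DIM('a) * ((real i + 1) * s\<^sup>2)"
    by (simp add: algebra_simps)
  also have "(real i + 1) * s\<^sup>2 = \<tau>\<^sup>2 * (1 / (real i + 1))"
    by (simp add: s_def power2_eq_square)
  finally show ?case
    using Suc.IH by (simp add: a_def b_def harm_Suc inverse_eq_divide algebra_simps)
qed

text \<open>The averaged proximal step moves \<xi> only slightly: since
  \<open>(i + 1) * s = \<tau>\<close>, the pull of the anchor \<open>u\<close> and that of the
  proximal map cancel up to \<open>\<tau> *\<^sub>R (g \<xi> - g (Q \<xi>))\<close>, which is of
  order \<open>s\<close>.\<close>

lemma inner_z_error:
  assumes "0 < \<tau>" and \<xi>: "prox_neglog \<tau> p u = \<xi>"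
  defines "L \<equiv> onorm (H 0) + K * (norm \<xi> + norm (u - \<xi>))"
  shows "(real n + 1) * norm (inner_z p \<tau> u n - \<xi>)
    \<le> norm (u - \<xi>) + (2 * K * real DIM('a) * \<tau>\<^sup>2 + L * \<tau> * norm (u - \<xi>)) * harm n"
proof (induction n)
  case 0
  show ?case by (simp add: harm_def)
next
  case (Suc i)
  define s where "s = \<tau> / (real i + 1)"
  define a where "a = inner_z p \<tau> u i"
  define Q where "Q = prox_neglog s p"
  define N where "N = MMSE p (sqrt s)"
  have s: "0 < s" "s \<le> \<tau>" "(real i + 1) * s = \<tau>" using assms by (auto simp: s_def field_simps)
  have u: "u - \<xi> = \<tau> *\<^sub>R g \<xi>"
    using prox_equation[OF \<open>0 < \<tau>\<close>, of u] by (simp add: \<xi> algebra_simps)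
  have disp: "norm (Q \<xi> - \<xi>) \<le> s * norm (g \<xi>)"
    unfolding Q_def by (rule prox_displacement[OF \<open>0 < s\<close>])
  also have "\<dots> \<le> norm (u - \<xi>)" using s \<open>0 < \<tau>\<close> by (simp add: u mult_right_mono)
  \<comment> \<open>This places \<open>Q \<xi>\<close>, like \<xi>, in the ball on which
    \<open>L\<close> is a Lipschitz constant of \<open>g\<close>.\<close>
  finally have "norm (Q \<xi>) \<le> norm \<xi> + norm (u - \<xi>)"
    using norm_triangle_ineq[of "Q \<xi> - \<xi>" \<xi>] by simp
  then have "norm (g \<xi> - g (Q \<xi>)) \<le> L * norm (\<xi> - Q \<xi>)"
    unfolding L_def by (intro g_lipschitz_on_cball) auto
  also have "\<dots> \<le> L * (s * norm (g \<xi>))"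
    using disp K_nonneg onorm_pos_le[OF has_derivative_bounded_linear[OF deriv2[of 0]]]
    by (intro mult_left_mono) (auto simp: L_def norm_minus_commute)
  finally have g: "\<tau> * norm (g \<xi> - g (Q \<xi>)) \<le> L * s * norm (u - \<xi>)"
    using \<open>0 < \<tau>\<close> by (simp add: u mult_ac)
  have "\<xi> - Q \<xi> = s *\<^sub>R g (Q \<xi>)"
    using prox_equation[OF \<open>0 < s\<close>, of \<xi>] by (simp add: Q_def algebra_simps)
  then have "(real i + 1) *\<^sub>R (\<xi> - Q \<xi>) = \<tau> *\<^sub>R g (Q \<xi>)" using s(3) by simp
  then have "(real i + 1) *\<^sub>R N a + u - (real i + 2) *\<^sub>R \<xi>
      = (real i + 1) *\<^sub>R ((N a - Q a) + (Q a - Q \<xi>)) + \<tau> *\<^sub>R (g \<xi> - g (Q \<xi>))"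
    using u by (simp add: algebra_simps scaleR_2)
  moreover have "(real i + 2) *\<^sub>R (inner_z p \<tau> u (Suc i) - \<xi>)
      = (real i + 1) *\<^sub>R N a + u - (real i + 2) *\<^sub>R \<xi>"
    unfolding inner_z_Suc by (simp add: N_def s_def a_def scaleR_add_right scaleR_diff_right)
  ultimately have "(real i + 2) * norm (inner_z p \<tau> u (Suc i) - \<xi>)
      = norm ((real i + 1) *\<^sub>R ((N a - Q a) + (Q a - Q \<xi>)) + \<tau> *\<^sub>R (g \<xi> - g (Q \<xi>)))"
    by (metis abs_of_nonneg add_nonneg_nonneg norm_scaleR of_nat_0_le_iff zero_le_numeral)
  also have "\<dots> \<le> (real i + 1) * norm ((N a - Q a) + (Q a - Q \<xi>)) + \<tau> * norm (g \<xi> - g (Q \<xi>))"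
    using \<open>0 < \<tau>\<close> by (intro order_trans[OF norm_triangle_ineq]) simp
  also have "norm ((N a - Q a) + (Q a - Q \<xi>)) \<le> 2 * K * real DIM('a) * s\<^sup>2 + norm (a - \<xi>)"
    unfolding N_def Q_def using \<open>0 < s\<close>
    by (intro order_trans[OF norm_triangle_ineq] add_mono MMSE_prox_dist prox_nonexpansive)
  also note g
  finally have "(real i + 2) * norm (inner_z p \<tau> u (Suc i) - \<xi>)
      \<le> (real i + 1) * (2 * K * real DIM('a) * s\<^sup>2 + norm (a - \<xi>)) + L * s * norm (u - \<xi>)" by simp
  also have "\<dots> = (real i + 1) * norm (a - \<xi>) + 2 * K * real DIM('a) * ((real i + 1) * s\<^sup>2)
      + L * s * norm (u - \<xi>)"
    by (simp add: algebra_simps)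
  also have "(real i + 1) * s\<^sup>2 = \<tau>\<^sup>2 * (1 / (real i + 1))"
    by (simp add: s_def power2_eq_square)
  also have "L * s * norm (u - \<xi>) = L * \<tau> * norm (u - \<xi>) * (1 / (real i + 1))"
    by (simp add: s_def)
  finally show ?case
    using Suc.IH by (simp add: a_def harm_Suc inverse_eq_divide algebra_simps)
qed

end

section \<open>The outer iteration\<close>

locale approx_prox_gradient = smooth_logconcave p g H K
  for p :: "'a::euclidean_space \<Rightarrow> real" and g H K +
  fixes f :: "'a \<Rightarrow> real" and gf :: "'a \<Rightarrow> 'a" and Lf lam \<tau> c \<eta> :: real and y xstar :: 'a
  assumes f_convex: "convex_on UNIV f"
    and f_deriv: "(f has_derivative (\<lambda>h. gf x \<bullet> h)) (at x)"
    and Lf_pos: "0 < Lf"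
    and f_smooth: "norm (gf x - gf x') \<le> Lf * norm (x - x')"
    and lam_pos: "0 < lam"
    and xstar_min: "lam * f xstar - ln (p xstar) \<le> lam * f x - ln (p x)"
    and tau_pos: "0 < \<tau>" and tau_le: "\<tau> \<le> 1 / (lam * Lf)"
    and c_pos: "0 < c" and eta_pos: "0 < \<eta>"
begin

section \<open>The exact proximal gradient step\<close>

definition J :: "'a \<Rightarrow> real" where "J x = lam * f x - ln (p x)"

definition fstep :: "'a \<Rightarrow> 'a" where "fstep x = x - (\<tau> * lam) *\<^sub>R gf x"

abbreviation X :: "nat \<Rightarrow> 'a" where "X \<equiv> xhat p gf \<tau> lam c \<eta> y"

abbreviation \<Xi> :: "nat \<Rightarrow> 'a" where "\<Xi> \<equiv> xexact p gf \<tau> lam c \<eta> y"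

definition rate :: "nat \<Rightarrow> real" where "rate k = (1 + ln (real k)) / real k powr (1 + \<eta>)"

lemma X_Suc: "X (Suc k) = inner_z p \<tau> (fstep (X k)) (n_iter c \<eta> (Suc k))"
  by (simp add: Let_def fstep_def)

lemma \<Xi>_Suc: "\<Xi> (Suc k) = prox_neglog \<tau> p (fstep (X k))"
  by (simp add: xexact_def Let_def fstep_def)

lemma tau_lam_Lf: "\<tau> * lam * Lf \<le> 1"
  using tau_le lam_pos Lf_pos by (simp add: field_simps)

lemma fstep_nonexpansive: "norm (fstep x - fstep x') \<le> norm (x - x')"
  unfolding fstep_def
proof (rule gradient_step_nonexpansive[OF f_convex f_deriv Lf_pos f_smooth])
  show "0 \<le> \<tau> * lam" using tau_pos lam_pos by simp
  show "\<tau> * lam \<le> 2 / Lf" using tau_lam_Lf Lf_pos by (simp add: field_simps)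
qed

text \<open>Stationarity of the objective at the minimiser, rewritten as the proximal
  equation.\<close>

lemma prox_fstep_xstar: "prox_neglog \<tau> p (fstep xstar) = xstar"
proof (rule prox_neglog_eqI[OF _ tau_pos])
  have "((\<lambda>x. lam * f x + (- ln (p x))) has_derivative (\<lambda>h. (lam *\<^sub>R gf xstar + g xstar) \<bullet> h)) (at xstar)"
    by (rule derivative_eq_intros f_deriv deriv refl | simp add: inner_simps)+
  then have "(\<lambda>h. (lam *\<^sub>R gf xstar + g xstar) \<bullet> h) = (\<lambda>h. 0)"
    by (rule has_derivative_local_min) (use xstar_min in \<open>simp add: always_eventually\<close>)
  then have "(lam *\<^sub>R gf xstar + g xstar) \<bullet> (lam *\<^sub>R gf xstar + g xstar) = 0" by metis
  then have "lam *\<^sub>R gf xstar + g xstar = 0" by (simp only: inner_eq_zero_iff)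
  then have "g xstar = - (lam *\<^sub>R gf xstar)" by (simp add: eq_neg_iff_add_eq_0 add.commute)
  then show "xstar + \<tau> *\<^sub>R g xstar = fstep xstar" by (simp add: fstep_def)
qed

text \<open>The sum of the three-point inequality for the proximal step, the descent inequality for
  \<open>f\<close> and convexity of \<open>f\<close>. The step size bound lets the proximal
  quadratic absorb the smoothness remainder.\<close>

lemma prox_gradient_decrease:
  assumes x: "x = prox_neglog \<tau> p (fstep v)"
  shows "J x - J w \<le> ((norm (v - w))\<^sup>2 - (norm (x - w))\<^sup>2) / (2 * \<tau>)"
proof -
  have 1: "1/2 * (norm (fstep v - x))\<^sup>2 - \<tau> * ln (p x) + 1/2 * (norm (w - x))\<^sup>2
    \<le> 1/2 * (norm (fstep v - w))\<^sup>2 - \<tau> * ln (p w)"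
    unfolding x by (rule prox_objective_strong[OF prox_equation[OF tau_pos] tau_pos])
  have "f x \<le> f v + gf v \<bullet> (x - v) + Lf / 2 * (norm (x - v))\<^sup>2"
    by (rule smooth_descent[OF f_deriv f_smooth])
  also have "f v \<le> f w - gf v \<bullet> (w - v)"
    using convex_on_gradient_le[OF f_convex f_deriv, of v w] by simp
  finally have "(\<tau> * lam) * f x \<le> (\<tau> * lam) * (f w + gf v \<bullet> (x - w) + Lf / 2 * (norm (x - v))\<^sup>2)"
    using tau_pos lam_pos by (intro mult_left_mono) (auto simp: inner_simps)
  also have "\<dots> = \<tau> * lam * f w + \<tau> * lam * (gf v \<bullet> (x - w)) + (\<tau> * lam * Lf) * (1/2 * (norm (x - v))\<^sup>2)"
    by (simp add: algebra_simps)
  also have "(\<tau> * lam * Lf) * (1/2 * (norm (x - v))\<^sup>2) \<le> 1 * (1/2 * (norm (x - v))\<^sup>2)"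
    using tau_lam_Lf by (intro mult_right_mono) auto
  finally have 2: "\<tau> * lam * f x \<le> \<tau> * lam * f w + \<tau> * lam * (gf v \<bullet> (x - w)) + 1/2 * (norm (x - v))\<^sup>2"
    by simp
  \<comment> \<open>Used at \<open>q = x\<close> and \<open>q = w\<close>: in the difference the
    squared gradient cancels, and the inner product left over cancels the one in
    \<open>2\<close>.\<close>
  have 3: "(norm (fstep v - q))\<^sup>2 = (norm (v - q))\<^sup>2 - 2 * (\<tau> * lam) * (gf v \<bullet> (v - q))
      + (norm ((\<tau> * lam) *\<^sub>R gf v))\<^sup>2" for q
    by (simp add: fstep_def power2_norm_eq_inner inner_simps inner_commute algebra_simps)
      (simp add: power2_eq_square)
  have "\<tau> * J x - \<tau> * J w \<le> 1/2 * ((norm (v - w))\<^sup>2 - (norm (x - w))\<^sup>2)"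
    using 1 2 unfolding 3 J_def
    by (simp add: inner_simps norm_minus_commute algebra_simps)
  then show ?thesis using tau_pos by (simp add: field_simps)
qed

section \<open>Summable errors and bounded iterates\<close>

lemma summable_rate: "summable rate"
  unfolding rate_def[abs_def] by (rule summable_ln_over_powr[OF eta_pos])

lemma rate_nonneg: "0 \<le> rate k"
  \<comment> \<open>At 0 the denominator is \<open>0 powr (1 + \<eta>) = 0\<close>, so the quotient
    is 0 by convention.\<close>
  by (cases "k = 0") (auto simp: rate_def)

lemma sum_rate_le: "(\<Sum>i<k. rate (Suc i)) \<le> suminf rate"
proof -
  have "(\<Sum>i<k. rate (Suc i)) \<le> sum rate {..<Suc k}"
    using rate_nonneg[of 0] by (subst sum.lessThan_Suc_shift) simp
  also have "\<dots> \<le> suminf rate"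
    by (rule sum_le_suminf[OF summable_rate]) (auto simp: rate_nonneg)
  finally show ?thesis .
qed

definition A :: real where "A = (3 + ln (c + 1) + \<eta>) / c"

lemma A_nonneg: "0 \<le> A"
  using c_pos eta_pos by (simp add: A_def)

lemma iteration_rate: "(1 + harm (n_iter c \<eta> (Suc k))) / (real (n_iter c \<eta> (Suc k)) + 1) \<le> A * rate (Suc k)"
  unfolding A_def rate_def by (rule n_iter_rate[OF c_pos eta_pos]) simp

text \<open>The radii \<open>R\<close> and \<open>r\<close> replace the norms at the particular
  input, so one constant serves all outer steps.\<close>

lemma inner_z_error_rate:
  assumes \<xi>: "prox_neglog \<tau> p u = \<xi>" and "norm \<xi> \<le> R" and "norm (u - \<xi>) \<le> r"
  shows "norm (inner_z p \<tau> u (n_iter c \<eta> (Suc k)) - \<xi>)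
    \<le> (r + 2 * K * real DIM('a) * \<tau>\<^sup>2 + (onorm (H 0) + K * (R + r)) * \<tau> * r) * A * rate (Suc k)"
    (is "_ \<le> ?E * A * rate (Suc k)")
proof -
  define n where "n = n_iter c \<eta> (Suc k)"
  have H0: "0 \<le> onorm (H 0)"
    by (rule onorm_pos_le[OF has_derivative_bounded_linear[OF deriv2[of 0]]])
  have h: "0 \<le> (harm n :: real)" by (rule harm_nonneg)
  have rR: "0 \<le> r" "0 \<le> R" using assms norm_ge_zero order_trans by blast+
  have "(onorm (H 0) + K * (norm \<xi> + norm (u - \<xi>))) * \<tau> * norm (u - \<xi>)
      \<le> (onorm (H 0) + K * (R + r)) * \<tau> * r" (is "?l \<le> ?m")
    using assms K_nonneg tau_pos H0 rR
    by (intro mult_mono add_mono mult_nonneg_nonneg add_nonneg_nonneg order_refl) auto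
  then have "norm (u - \<xi>) + (2 * K * real DIM('a) * \<tau>\<^sup>2 + ?l) * harm n
      \<le> r + (2 * K * real DIM('a) * \<tau>\<^sup>2 + ?m) * harm n"
    using h by (intro add_mono[OF \<open>norm (u - \<xi>) \<le> r\<close>] mult_right_mono add_left_mono)
  \<comment> \<open>The first term also receives the factor \<open>1 + harm n\<close>, so that a
    single product fits \<open>iteration_rate\<close>.\<close>
  also have "\<dots> \<le> ?E * (1 + harm n)"
  proof -
    have "0 \<le> r * harm n" "0 \<le> 2 * K * real DIM('a) * \<tau>\<^sup>2" "0 \<le> ?m"
      using h rR K_nonneg H0 tau_pos by auto
    moreover have "?E * (1 + harm n) = r + (2 * K * real DIM('a) * \<tau>\<^sup>2 + ?m) * harm n
        + (2 * K * real DIM('a) * \<tau>\<^sup>2 + ?m + r * harm n)"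
      by (simp only: ring_distribs mult_1_right)
    ultimately show ?thesis by linarith
  qed
  finally have "(real n + 1) * norm (inner_z p \<tau> u n - \<xi>) \<le> ?E * (1 + harm n)"
    using inner_z_error[OF tau_pos \<xi>, of n] by linarith
  then have "norm (inner_z p \<tau> u n - \<xi>) \<le> ?E * ((1 + harm n) / (real n + 1))"
    by (simp add: field_simps)
  also have "\<dots> \<le> ?E * (A * rate (Suc k))"
    unfolding n_def using rR K_nonneg H0 tau_pos by (intro mult_left_mono iteration_rate) auto
  finally show ?thesis by (simp add: n_def mult.assoc)
qed

text \<open>Both \<open>fstep\<close> and, up to summable errors, the inner loop are nonexpansive, and their composition
  approximately fixes \<open>xstar\<close>.\<close>

lemma X_bounded: "\<exists>R. \<forall>k. norm (X k - xstar) \<le> R"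
proof -
  define us where "us = fstep xstar"
  define r where "r = norm (us - xstar)"
  define E where "E = (r + 2 * K * real DIM('a) * \<tau>\<^sup>2 + (onorm (H 0) + K * (norm xstar + r)) * \<tau> * r) * A"
  define D where "D = E + 4 * K * real DIM('a) * \<tau>\<^sup>2 * A"
  have H0: "0 \<le> onorm (H 0)"
    by (rule onorm_pos_le[OF has_derivative_bounded_linear[OF deriv2[of 0]]])
  have "0 \<le> D"
    unfolding D_def E_def r_def using K_nonneg A_nonneg H0 tau_pos by simp
  \<comment> \<open>The inner loop from the current iterate is compared with the one from
    \<open>us\<close>. The error bound is applied only at the fixed input \<open>us\<close>, so
    \<open>D\<close> does not depend on \<open>k\<close> and no circularity arises.\<close>
  have step: "norm (X (Suc k) - xstar) \<le> norm (X k - xstar) + D * rate (Suc k)" for k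
  proof -
    define n where "n = n_iter c \<eta> (Suc k)"
    define u where "u = fstep (X k)"
    have "(real n + 1) * norm (inner_z p \<tau> u n - inner_z p \<tau> us n)
        \<le> (real n + 1) * norm (u - us) + 4 * K * real DIM('a) * \<tau>\<^sup>2 * (1 + harm n)"
    proof -
      have "0 \<le> 4 * K * real DIM('a) * \<tau>\<^sup>2" using K_nonneg by simp
      then show ?thesis
        using inner_z_stable[OF tau_pos, of n u us] by (simp only: ring_distribs mult_1_right)
    qed
    then have "norm (inner_z p \<tau> u n - inner_z p \<tau> us n)
        \<le> norm (u - us) + 4 * K * real DIM('a) * \<tau>\<^sup>2 * ((1 + harm n) / (real n + 1))"
      by (simp add: field_simps)
    also have "norm (u - us) \<le> norm (X k - xstar)"
      unfolding u_def us_def by (rule fstep_nonexpansive)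
    also have "4 * K * real DIM('a) * \<tau>\<^sup>2 * ((1 + harm n) / (real n + 1))
        \<le> 4 * K * real DIM('a) * \<tau>\<^sup>2 * (A * rate (Suc k))"
      unfolding n_def using K_nonneg by (intro mult_left_mono iteration_rate) auto
    finally have "norm (inner_z p \<tau> u n - inner_z p \<tau> us n)
        \<le> norm (X k - xstar) + 4 * K * real DIM('a) * \<tau>\<^sup>2 * (A * rate (Suc k))" by simp
    moreover have "norm (inner_z p \<tau> us n - xstar) \<le> E * rate (Suc k)"
      unfolding n_def E_def us_def r_def
      by (rule inner_z_error_rate[OF prox_fstep_xstar]) auto
    moreover have "norm (X (Suc k) - xstar)
        \<le> norm (inner_z p \<tau> u n - inner_z p \<tau> us n) + norm (inner_z p \<tau> us n - xstar)"
      using norm_triangle_ineq[of "inner_z p \<tau> u n - inner_z p \<tau> us n" "inner_z p \<tau> us n - xstar"]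
      by (simp add: X_Suc u_def n_def del: xhat.simps)
    ultimately show ?thesis by (simp add: D_def algebra_simps)
  qed
  have "norm (X k - xstar) \<le> norm (y - xstar) + D * (\<Sum>i<k. rate (Suc i))" for k
  proof (induction k)
    case (Suc k)
    then show ?case using step[of k] by (simp add: algebra_simps)
  qed simp
  moreover have "D * (\<Sum>i<k. rate (Suc i)) \<le> D * suminf rate" for k
    using sum_rate_le \<open>0 \<le> D\<close> by (rule mult_left_mono)
  ultimately show ?thesis
    by (intro exI[of _ "norm (y - xstar) + D * suminf rate"]) (meson add_left_mono order_trans)
qed

lemma \<Xi>_dist_le: "norm (\<Xi> (Suc k) - xstar) \<le> norm (X k - xstar)"
  using prox_nonexpansive[OF tau_pos, of "fstep (X k)" "fstep xstar"] fstep_nonexpansive[of "X k" xstar]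
  by (simp add: \<Xi>_Suc prox_fstep_xstar)

lemma X_error: "\<exists>C\<ge>0. \<forall>k. norm (X (Suc k) - \<Xi> (Suc k)) \<le> C * rate (Suc k)"
proof -
  obtain R where R: "\<And>k. norm (X k - xstar) \<le> R" using X_bounded by blast
  \<comment> \<open>The path from \<open>fstep (X k)\<close> to the exact update runs through
    \<open>fstep xstar\<close> and \<open>xstar\<close>; the first and last legs have length at most
    \<open>R\<close>.\<close>
  define r where "r = 2 * R + norm (fstep xstar - xstar)"
  define C where "C = (r + 2 * K * real DIM('a) * \<tau>\<^sup>2
      + (onorm (H 0) + K * ((norm xstar + R) + r)) * \<tau> * r) * A"
  have "0 \<le> R" using R[of 0] norm_ge_zero order_trans by blast
  then have "0 \<le> r" by (simp add: r_def)
  have "norm (X (Suc k) - \<Xi> (Suc k)) \<le> C * rate (Suc k)" for k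
    unfolding X_Suc C_def
  proof (rule inner_z_error_rate)
    show "prox_neglog \<tau> p (fstep (X k)) = \<Xi> (Suc k)" by (simp add: \<Xi>_Suc)
    have \<Xi>: "norm (\<Xi> (Suc k) - xstar) \<le> R" using \<Xi>_dist_le[of k] R[of k] by linarith
    then show "norm (\<Xi> (Suc k)) \<le> norm xstar + R"
      using norm_triangle_sub[of "\<Xi> (Suc k)" xstar] by linarith
    have "norm (fstep (X k) - fstep xstar) \<le> R"
      using fstep_nonexpansive[of "X k" xstar] R[of k] by linarith
    moreover have "fstep (X k) - \<Xi> (Suc k)
        = (fstep (X k) - fstep xstar) + ((fstep xstar - xstar) + (xstar - \<Xi> (Suc k)))" by simp
    ultimately show "norm (fstep (X k) - \<Xi> (Suc k)) \<le> r"
      using \<Xi> norm_triangle_ineq[of "fstep (X k) - fstep xstar" "(fstep xstar - xstar) + (xstar - \<Xi> (Suc k))"]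
        norm_triangle_ineq[of "fstep xstar - xstar" "xstar - \<Xi> (Suc k)"]
      unfolding r_def by (simp only: norm_minus_commute[of xstar "\<Xi> (Suc k)"])
  qed
  moreover have "0 \<le> C"
    unfolding C_def using K_nonneg A_nonneg tau_pos \<open>0 \<le> R\<close> \<open>0 \<le> r\<close>
      onorm_pos_le[OF has_derivative_bounded_linear[OF deriv2[of 0]]] by simp
  ultimately show ?thesis by blast
qed

text \<open>The decrease inequality ends at the exact update, whereas the next step starts at the
  approximate one. Exchanging the two squared distances costs at most \<open>2 * R\<close> times the
  summable error, and the rest telescopes.\<close>

lemma J_sum_bounded: "\<exists>C>0. \<forall>k. (\<Sum>i=1..k. J (\<Xi> i) - J xstar) \<le> C"
proof -
  obtain R where R: "\<And>k. norm (X k - xstar) \<le> R" using X_bounded by blast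
  obtain E where E: "0 \<le> E" "\<And>k. norm (X (Suc k) - \<Xi> (Suc k)) \<le> E * rate (Suc k)"
    using X_error by blast
  have "0 \<le> R" using R[of 0] norm_ge_zero order_trans by blast
  have step: "J (\<Xi> (Suc k)) - J xstar
      \<le> ((norm (X k - xstar))\<^sup>2 - (norm (X (Suc k) - xstar))\<^sup>2 + 2 * R * E * rate (Suc k)) / (2 * \<tau>)" for k
  proof -
    define a b where "a = norm (X (Suc k) - xstar)" and "b = norm (\<Xi> (Suc k) - xstar)"
    have "a \<le> R" "b \<le> R" "0 \<le> a" "0 \<le> b"
      using R[of k] R[of "Suc k"] \<Xi>_dist_le[of k] unfolding a_def b_def by auto
    have "a\<^sup>2 - b\<^sup>2 = (a - b) * (a + b)" by (simp add: power2_eq_square algebra_simps)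
    also have "\<dots> \<le> norm (X (Suc k) - \<Xi> (Suc k)) * (a + b)"
      using norm_triangle_ineq2[of "X (Suc k) - xstar" "\<Xi> (Suc k) - xstar"] \<open>0 \<le> a\<close> \<open>0 \<le> b\<close>
      unfolding a_def b_def by (intro mult_right_mono) auto
    also have "\<dots> \<le> (E * rate (Suc k)) * (2 * R)"
      using E \<open>a \<le> R\<close> \<open>b \<le> R\<close> \<open>0 \<le> a\<close> \<open>0 \<le> b\<close> rate_nonneg by (intro mult_mono) auto
    finally have "a\<^sup>2 - b\<^sup>2 \<le> 2 * R * E * rate (Suc k)" by (simp add: mult_ac)
    then have "((norm (X k - xstar))\<^sup>2 - b\<^sup>2) / (2 * \<tau>)
        \<le> ((norm (X k - xstar))\<^sup>2 - a\<^sup>2 + 2 * R * E * rate (Suc k)) / (2 * \<tau>)"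
      using tau_pos by (intro divide_right_mono) auto
    moreover have "J (\<Xi> (Suc k)) - J xstar \<le> ((norm (X k - xstar))\<^sup>2 - b\<^sup>2) / (2 * \<tau>)"
      unfolding b_def by (rule prox_gradient_decrease[OF \<Xi>_Suc])
    ultimately show ?thesis unfolding a_def by linarith
  qed
  define C where "C = ((norm (y - xstar))\<^sup>2 + 2 * R * E * suminf rate) / (2 * \<tau>)"
  have "(\<Sum>i=1..k. J (\<Xi> i) - J xstar) \<le> C" for k
  proof -
    have "(\<Sum>i=1..k. J (\<Xi> i) - J xstar)
        \<le> ((norm (y - xstar))\<^sup>2 - (norm (X k - xstar))\<^sup>2 + 2 * R * E * (\<Sum>i<k. rate (Suc i))) / (2 * \<tau>)"
    proof (induction k)
      case (Suc k)
      have "(\<Sum>i=1..Suc k. J (\<Xi> i) - J xstar) = (\<Sum>i=1..k. J (\<Xi> i) - J xstar) + (J (\<Xi> (Suc k)) - J xstar)"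
        by simp
      also note add_mono[OF Suc.IH step[of k]]
      finally show ?case by (simp add: algebra_simps add_divide_distrib diff_divide_distrib)
    qed simp
    also have "\<dots> \<le> C"
    proof -
      have "2 * R * E * (\<Sum>i<k. rate (Suc i)) \<le> 2 * R * E * suminf rate"
        using E(1) \<open>0 \<le> R\<close> by (intro mult_left_mono sum_rate_le) auto
      then show ?thesis
        unfolding C_def using tau_pos zero_le_power2[of "norm (X k - xstar)"]
        by (intro divide_right_mono) linarith+
    qed
    finally show ?thesis .
  qed
  then show ?thesis
    by (intro exI[of _ "\<bar>C\<bar> + 1"]) (auto intro: order_trans[of _ C])
qed

lemma rates:
  "\<exists>C1>0. \<exists>C2>0. \<forall>k\<ge>1. (1 / real k) * (\<Sum>i = 1..k. J (\<Xi> i)) - J xstar \<le> C1 / real k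
    \<and> norm (X k - \<Xi> k) \<le> C2 * (1 + ln (real k)) / real k powr (1 + \<eta>)"
proof -
  obtain C1 where C1: "0 < C1" "\<And>k. (\<Sum>i=1..k. J (\<Xi> i) - J xstar) \<le> C1"
    using J_sum_bounded by blast
  obtain E where E: "0 \<le> E" "\<And>k. norm (X (Suc k) - \<Xi> (Suc k)) \<le> E * rate (Suc k)"
    using X_error by blast
  have "(1 / real k) * (\<Sum>i = 1..k. J (\<Xi> i)) - J xstar \<le> C1 / real k" if "1 \<le> k" for k
  proof -
    have "(1 / real k) * (\<Sum>i = 1..k. J (\<Xi> i)) - J xstar = (\<Sum>i=1..k. J (\<Xi> i) - J xstar) / real k"
      using that by (simp add: sum_subtractf field_simps)
    also have "\<dots> \<le> C1 / real k" using C1(2) by (rule divide_right_mono) simp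
    finally show ?thesis .
  qed
  \<comment> \<open>\<open>E\<close> may be 0; \<open>E + 1\<close> supplies a strictly positive
    constant.\<close>
  moreover have "norm (X k - \<Xi> k) \<le> (E + 1) * (1 + ln (real k)) / real k powr (1 + \<eta>)" if "1 \<le> k" for k
  proof -
    have "norm (X k - \<Xi> k) \<le> E * rate k" using E(2)[of "k - 1"] that by simp
    also have "\<dots> \<le> (E + 1) * rate k" using rate_nonneg by (intro mult_right_mono) auto
    finally show ?thesis by (simp add: rate_def)
  qed
  ultimately show ?thesis
    using C1(1) E(1) by (intro exI[of _ C1] exI[of _ "E + 1"] conjI allI impI) auto
qed

end

section \<open>Lipschitz Hessian from a bounded third derivative\<close>

lemma abs_tensor_component_le_frob:
  assumes "i \<in> Basis" "j \<in> Basis" "k \<in> Basis"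
  shows "\<bar>T i j k\<bar> \<le> tensor3_frob T"
proof -
  have "(T i j k)\<^sup>2 \<le> (\<Sum>k\<in>Basis. (T i j k)\<^sup>2)"
    using assms by (intro member_le_sum) auto
  also have "\<dots> \<le> (\<Sum>j\<in>Basis. \<Sum>k\<in>Basis. (T i j k)\<^sup>2)"
    using assms by (intro member_le_sum[where f = "\<lambda>j. \<Sum>k\<in>Basis. (T i j k)\<^sup>2"]) (auto intro: sum_nonneg)
  also have "\<dots> \<le> (\<Sum>i\<in>Basis. \<Sum>j\<in>Basis. \<Sum>k\<in>Basis. (T i j k)\<^sup>2)"
    using assms by (intro member_le_sum[where f = "\<lambda>i. \<Sum>j\<in>Basis. \<Sum>k\<in>Basis. (T i j k)\<^sup>2"])
      (auto intro!: sum_nonneg)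
  finally show ?thesis unfolding tensor3_frob_def by (intro real_le_rsqrt) simp
qed

lemma abs_linear_le_sum_basis:
  fixes l :: "'a::euclidean_space \<Rightarrow> real"
  assumes "linear l" and "\<And>b. b \<in> Basis \<Longrightarrow> \<bar>l b\<bar> \<le> B"
  shows "\<bar>l h\<bar> \<le> real DIM('a) * B * norm h"
proof -
  have "l h = l (\<Sum>b\<in>Basis. (h \<bullet> b) *\<^sub>R b)" by (simp add: euclidean_representation)
  also have "\<dots> = (\<Sum>b\<in>Basis. (h \<bullet> b) * l b)"
    using assms(1) by (simp add: linear_sum linear_cmul)
  also have "\<bar>\<dots>\<bar> \<le> (\<Sum>b\<in>Basis. \<bar>(h \<bullet> b) * l b\<bar>)" by (rule sum_abs)
  also have "\<dots> \<le> (\<Sum>b\<in>(Basis::'a set). norm h * B)"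
    unfolding abs_mult by (intro sum_mono mult_mono Basis_le_norm assms(2)) auto
  finally show ?thesis by (simp add: mult_ac)
qed

text \<open>Being derivatives, \<open>D1\<close>, \<open>D2\<close> and \<open>D3\<close> are linear
  in their last argument. Expansion in the basis is done there only, the other slots holding basis
  vectors. Two expansions and the final sum over components give the cube of the dimension.\<close>

lemma thrice_derivs_hessian_lipschitz:
  fixes q :: "'a::euclidean_space \<Rightarrow> real"
  assumes d: "thrice_derivs q D1 D2 D3" and M: "\<And>x. tensor3_frob (D3 x) \<le> M"
  obtains g H K where "\<And>x. (q has_derivative (\<lambda>h. g x \<bullet> h)) (at x)"
    "\<And>x. (g has_derivative H x) (at x)"
    "\<And>x y h. norm (H x h - H y h) \<le> K * norm (x - y) * norm h" "0 \<le> K"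
proof
  let ?d = "real DIM('a)"
  define g where "g x = (\<Sum>b\<in>Basis. D1 x b *\<^sub>R b)" for x
  define H where "H x h = (\<Sum>b\<in>Basis. D2 x b h *\<^sub>R b)" for x h
  have d1: "(q has_derivative D1 x) (at x)"
    and d2: "((\<lambda>x'. D1 x' u) has_derivative D2 x u) (at x)"
    and d3: "((\<lambda>x'. D2 x' u v) has_derivative D3 x u v) (at x)" for x u v
    using d by (auto simp: thrice_derivs_def)
  have "D1 x h = g x \<bullet> h" for x h
  proof -
    have "D1 x h = D1 x (\<Sum>b\<in>Basis. (h \<bullet> b) *\<^sub>R b)" by (simp add: euclidean_representation)
    also have "\<dots> = (\<Sum>b\<in>Basis. (h \<bullet> b) * D1 x b)"
      using has_derivative_linear[OF d1] by (simp add: linear_sum linear_cmul)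
    finally show ?thesis by (simp add: g_def inner_sum_left inner_commute[of h] mult.commute)
  qed
  then have "D1 x = (\<lambda>h. g x \<bullet> h)" for x by blast
  then show "(q has_derivative (\<lambda>h. g x \<bullet> h)) (at x)" for x using d1[of x] by simp
  show "(g has_derivative H x) (at x)" for x
    unfolding g_def[abs_def] H_def[abs_def] by (intro has_derivative_sum has_derivative_scaleR_left d2)
  have "0 \<le> tensor3_frob (D3 0)" unfolding tensor3_frob_def by (intro real_sqrt_ge_zero sum_nonneg) auto
  then have "0 \<le> M" using M[of 0] by linarith
  then show "0 \<le> ?d * (?d * (?d * M))" by simp
  fix x y h :: 'a
  have bb: "\<bar>D2 x b v - D2 y b v\<bar> \<le> ?d * M * norm (x - y)" if b: "b \<in> Basis" "v \<in> Basis" for b v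
  proof -
    have "norm (D2 x b v - D2 y b v) \<le> ?d * M * norm (x - y)"
    proof (rule differentiable_bound[where S = UNIV and f' = "\<lambda>x. D3 x b v"])
      fix w
      have "\<bar>D3 w b v e\<bar> \<le> ?d * M * norm e" for e
        using abs_tensor_component_le_frob[OF b, of _ "D3 w"] M[of w]
        by (intro abs_linear_le_sum_basis has_derivative_linear[OF d3]) (meson order_trans)
      then show "onorm (D3 w b v) \<le> ?d * M" by (intro onorm_le) simp
    qed (auto simp: d3)
    then show ?thesis by simp
  qed
  have "\<bar>D2 x b h - D2 y b h\<bar> \<le> ?d * (?d * M * norm (x - y)) * norm h" if b: "b \<in> Basis" for b
    by (rule abs_linear_le_sum_basis[OF linear_compose_sub bb[OF b]])
      (rule has_derivative_linear[OF d2])+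
  then have "norm (H x h - H y h) \<le> (\<Sum>b\<in>(Basis::'a set). ?d * (?d * M * norm (x - y)) * norm h)"
    unfolding H_def sum_subtractf[symmetric] scaleR_diff_left[symmetric]
    by (intro sum_norm_le) simp
  then show "norm (H x h - H y h) \<le> ?d * (?d * (?d * M)) * norm (x - y) * norm h"
    by (simp add: mult_ac)
qed

section \<open>Instantiation with the given data\<close>

theorem theorem2:
  fixes p :: "'a::euclidean_space \<Rightarrow> real"
    and f :: "'a \<Rightarrow> real" and gf :: "'a \<Rightarrow> 'a"
    and Lf lam \<tau> c \<eta> :: real and y xstar :: 'a
  assumes p_nonneg: "\<forall>x. 0 \<le> p x"
    and p_integrable: "integrable lborel p"
    and p_total: "(\<integral>x. p x \<partial>lborel) = 1"
    and p_pos: "\<forall>x. p x > 0"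
    and p_logconcave: "concave_on UNIV (\<lambda>x. ln (p x))"
    and p_C3: "thrice_differentiable p"
    and M_finite: "\<exists>D1 D2 D3 M. thrice_derivs (\<lambda>x. ln (p x)) D1 D2 D3 \<and>
                       (\<forall>x. tensor3_frob (D3 x) \<le> M)"
    and f_convex: "convex_on UNIV f"
    and f_bdd_below: "\<exists>b. \<forall>x. b \<le> f x"
    and f_grad: "\<forall>x. (f has_derivative (\<lambda>h. gf x \<bullet> h)) (at x)"
    and Lf_pos: "Lf > 0"
    and f_smooth: "\<forall>x x'. norm (gf x - gf x') \<le> Lf * norm (x - x')"
    and lambda_pos: "lam > 0"
    and xstar_min: "\<forall>x. lam * f xstar - ln (p xstar) \<le> lam * f x - ln (p x)"
    and tau_pos: "0 < \<tau>" and tau_le: "\<tau> \<le> 1 / (lam * Lf)"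
    and c_pos: "c > 0" and eta_pos: "\<eta> > 0"
  shows "\<exists>C1 > 0. \<exists>C2 > 0. \<forall>k::nat. k \<ge> 1 \<longrightarrow>
           (1 / real k) * (\<Sum>i = 1..k. lam * f (xexact p gf \<tau> lam c \<eta> y i)
                                        - ln (p (xexact p gf \<tau> lam c \<eta> y i)))
             - (lam * f xstar - ln (p xstar)) \<le> C1 / real k
           \<and> norm (xhat p gf \<tau> lam c \<eta> y k - xexact p gf \<tau> lam c \<eta> y k)
               \<le> C2 * (1 + ln (real k)) / real k powr (1 + \<eta>)"
proof -
  obtain D1 D2 D3 M where d: "thrice_derivs (\<lambda>x. ln (p x)) D1 D2 D3"
      and M: "\<And>x. tensor3_frob (D3 x) \<le> M"
    using M_finite by blast
  obtain g H K where g: "\<And>x. ((\<lambda>x. ln (p x)) has_derivative (\<lambda>h. g x \<bullet> h)) (at x)"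
    and H: "\<And>x. (g has_derivative H x) (at x)"
    and K: "\<And>x y h. norm (H x h - H y h) \<le> K * norm (x - y) * norm h" "0 \<le> K"
    using thrice_derivs_hessian_lipschitz[OF d M] by metis
  \<comment> \<open>The derivatives obtained belong to \<open>ln p\<close>, those of the locale to
    \<open>- ln p\<close>; hence the signs.\<close>
  interpret approx_prox_gradient p "\<lambda>x. - g x" "\<lambda>x h. - H x h" K f gf Lf lam \<tau> c \<eta> y xstar
  proof
    show "convex_on UNIV (\<lambda>x. - ln (p x))" using p_logconcave by (simp add: concave_on_def)
    show "((\<lambda>x. - ln (p x)) has_derivative (\<lambda>h. - g x \<bullet> h)) (at x)" for x
      using has_derivative_minus[OF g[of x]] by simp
    show "((\<lambda>x. - g x) has_derivative (\<lambda>h. - H x h)) (at x)" for x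
      by (rule has_derivative_minus[OF H])
    show "norm (- H x h - - H x' h) \<le> K * norm (x - x') * norm h" for x x' h
      using K(1)[of x h x'] by (simp add: norm_minus_commute)
  qed (use assms K in auto)
  show ?thesis using rates unfolding J_def .
qed

end
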